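(* Let $f=0$ and $\tau,\beta\ge 0$, and let $(u_h,v_h)$, with $u_h(t)\in U_h^p$ and $v_h(t)\in V_h^q$, be a solution of the semi-discrete stabilized CutEDG scheme (given in the context, with homogeneous Dirichlet boundary fluxes). Define the discrete energy $$E_h(t)=\frac12\sum_{K\in\mathcal T_h}\int_{K_\Omega}\left(|\nabla u_h|^2+|v_h|^2\right)\,d\mathbf x .$$ Then $$\frac{d}{dt}\left(E_h(t)+\tfrac12\gamma_M^{(u)}h^{-2}J_p(u_h,u_h)+\tfrac12\gamma_M^{(v)}J_q(v_h,v_h)\right)\le 0 .$$
   Context: **Problem.** $\Omega\subset\mathbb R^d$ is a bounded domain with boundary $\Gamma=\partial\Omega$. The wave equation $u_{tt}=\Delta u+f$ in $\Omega\times(0,T)$ with $u=0$ on $\Gamma$ is written as $u_t=v$, $v_t=\Delta u+f$. **Mesh.** $\widetilde{\mathcal T}_h$ is a Cartesian background mesh covering $\Omega$, constructed independently of $\Gamma$; $h=\max_{K\in\widetilde{\mathcal T}_h}\operatorname{diam}(K)$. The active mesh is $\mathcal T_h=\{K\in\widetilde{\mathcal T}_h:|K\cap\Omega|>0\}$. For $K\in\mathcal T_h$, $K_\Omega=K\cap\Omega$, with outward unit normal $\mathbf n_{\Omega,K}$ on $\partial K_\Omega$. Further, $\mathcal T_h^{\mathrm{int}}=\{K\in\mathcal T_h:\overline K\subset\Omega\}$ and $\mathcal T_h^\Gamma=\mathcal T_h\setminus\mathcal T_h^{\mathrm{int}}$ (cut cells). **Faces.** $\mathcal F_h^{\mathrm{int}}$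 is the set of faces $F=\partial K^+\cap\partial K^-$, $K^\pm\in\mathcal T_h$, of positive $(d-1)$-dimensional measure. $\mathcal F_h^\Omega=\{F\cap\Omega:F\in\mathcal F_h^{\mathrm{int}},\ \operatorname{meas}_{d-1}(F\cap\Omega)>0\}$. The ghost-penalty faces are $\mathcal F_h^g=\{F=\partial K^+\cap\partial K^-\in\mathcal F_h^{\mathrm{int}}: K^+\in\mathcal T_h^\Gamma\text{ or }K^-\in\mathcal T_h^\Gamma\}$. **Spaces.** $U_h^p$ (resp. $V_h^q$) is the space of functions on the active mesh whose restriction to each full cell $K\in\mathcal T_h$ is a polynomial in $\mathcal P^p(K)$ (resp. $\mathcal P^q(K)$), with no continuity across faces; $\mathcal P^r$ denotes total-degree or tensor-product polynomials of degree $r$. $U_h^0$ is the space of piecewise constants. **Jumps and fluxes.** On a face shared by $K^\pm$, with outward normals $\mathbf n^-=-\mathbf n^+$ and traces $w^\pm$ from $K^\pm$, set $[\![w]\!]=w^+\mathbf n^++w^-\mathbf n^-$ for scalars and $[\![\mathbf q]\!]=\mathbf q^+\cdot\mathbf n^++\mathbf q^-\cdot\mathbf n^-$ for vectors. On faces in $\mathcal F_h^\Omega$ the numerical fluxes are $$\widehat{v_h}=\alpha v_h^++(1-\alpha)v_h^--\tau[\![\nabla u_h]\!],\qquad \widehat{\nabla u_h}=(1-\alpha)\nabla u_h^++\alpha\nabla u_h^--\beta[\![v_h]\!],$$ with fixed real parameters $\alpha,\tau,\beta$; on portions of $\Gamma$: $\widehat{v_h}=0$, $\widehat{\nabla u_h}=\nabla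 u_h$. **Ghost penalty.** For a polynomial degree $r$, $$J_r(w,z)=\sum_{F\in\mathcal F_h^g}\sum_{\ell=0}^r\omega_\ell\frac{h^{2\ell+1}}{(2\ell+1)(\ell!)^2}\int_F[\![\partial_{n_F}^\ell w]\!]\,[\![\partial_{n_F}^\ell z]\!]\,dS,$$ integrated over the full background face $F$, where $n_F$ is a fixed unit normal of $F$, $\partial_{n_F}^\ell$ is the $\ell$-th directional derivative along $n_F$, $\omega_\ell>0$ are weights, and the product of jumps is the product of the differences of the traces from the two sides (dot product of the vector jumps). **Stabilized CutEDG scheme.** With stabilization parameters $\gamma_M^{(u)},\gamma_M^{(v)}>0$: for all $(\phi_u,\phi_v,\widetilde\phi)\in U_h^p\times V_h^q\times U_h^0$, $$\sum_{K\in\mathcal T_h}\int_{K_\Omega}\nabla\phi_u\cdot\nabla((u_h)_t-v_h)\,d\mathbf x+\gamma_M^{(u)}h^{-2}J_p((u_h)_t,\phi_u)=\sum_{K\in\mathcal T_h}\int_{\partial K_\Omega}(\widehat{v_h}-v_h)\nabla\phi_u\cdot\mathbf n_{\Omega,K}\,dS,$$ $$\sum_{K\in\mathcal T_h}\int_{K_\Omega}\left(\phi_v(v_h)_t+\nabla\phi_v\cdot\nabla u_h\right)d\mathbf x+\gamma_M^{(v)}J_q((v_h)_t,\phi_v)=\sum_{K\in\mathcal T_h}\int_{\partial K_\Omega}\phi_v\,\widehat{\nabla u_h}\cdot\mathbf n_{\Omega,K}\,dS+\sum_{K\in\mathcal T_h}\int_{K_\Omega}\phi_vf\,d\mathbf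 x,$$ $$\sum_{K\in\mathcal T_h}\int_{K_\Omega}h^{-2}\widetilde\phi\,((u_h)_t-v_h)\,d\mathbf x+\gamma_M^{(u)}h^{-2}J_p((u_h)_t,\widetilde\phi)=0.$$ *)

theory Defs
  imports "HOL-Analysis.Analysis"
begin

section \<open>Surface measure and outward normals\<close>

text \<open>The Hausdorff measure is normalised by the volume of the unit ball, so that on
  \<open>m\<close>-dimensional planes it is Lebesgue measure. The empty set has weight \<open>0\<close> also
  for \<open>m = 0\<close>, and the covering sets have to be bounded because the library sets the
  diameter of an unbounded set to \<open>0\<close>.\<close>

definition hausdorff_weight :: "nat \<Rightarrow> 'a::metric_space set \<Rightarrow> ennreal" where
  "hausdorff_weight m C =
     (if C = {} then 0 else ennreal (unit_ball_vol (real m) * (diameter C / 2) ^ m))"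

definition hausdorff_pre :: "nat \<Rightarrow> real \<Rightarrow> 'a::metric_space set \<Rightarrow> ennreal" where
  "hausdorff_pre m \<delta> A =
     (INF C \<in> {C :: nat \<Rightarrow> 'a set. A \<subseteq> (\<Union>i. C i) \<and> (\<forall>i. bounded (C i) \<and> diameter (C i) \<le> \<delta>)}.
        (\<Sum>i. hausdorff_weight m (C i)))"

definition hausdorff_outer :: "nat \<Rightarrow> 'a::metric_space set \<Rightarrow> ennreal" where
  "hausdorff_outer m A = (SUP \<delta>\<in>{0<..}. hausdorff_pre m \<delta> A)"

text \<open>The surface measure \<open>dS\<close> is the \<open>(d-1)\<close>-dimensional Hausdorff measure. It comes from a
  metric outer measure, which is countably additive on the Borel sets.\<close>

definition surface_measure :: "'a::euclidean_space measure" where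
  "surface_measure = measure_of UNIV (sets borel) (hausdorff_outer (DIM('a) - 1))"

text \<open>\<open>n\<close> is the outward unit normal of \<open>A\<close> at \<open>x\<close> if, near \<open>x\<close>, \<open>A\<close> differs from
  the half-space \<open>{y. (y - x) \<bullet> n < 0}\<close> only inside arbitrarily flat cones around its
  bounding hyperplane. There is at most one such \<open>n\<close>; for a set that is locally the
  subgraph of a function, this is the usual normal wherever the function is differentiable.\<close>

definition is_outward_normal :: "'a::euclidean_space set \<Rightarrow> 'a \<Rightarrow> 'a \<Rightarrow> bool" where
  "is_outward_normal A x n \<longleftrightarrow> norm n = 1 \<and>
     (\<forall>\<epsilon>>0. \<exists>\<delta>>0. \<forall>y. dist y x < \<delta> \<longrightarrow>
        ((y - x) \<bullet> n < - \<epsilon> * norm (y - x) \<longrightarrow> y \<in> A) \<and>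
        ((y - x) \<bullet> n > \<epsilon> * norm (y - x) \<longrightarrow> y \<notin> A))"

text \<open>The value \<open>0\<close> marks the points without normal (such as edges of a cell).\<close>

definition outward_normal :: "'a::euclidean_space set \<Rightarrow> 'a \<Rightarrow> 'a" where
  "outward_normal A x =
     (if \<exists>n. is_outward_normal A x n then (THE n. is_outward_normal A x n) else 0)"

text \<open>The regularity of the boundary without which the boundary integrals of the scheme
  would be meaningless: finite surface measure and a normal almost everywhere. Bounded
  Lipschitz domains have both.\<close>

definition bounded_domain :: "'a::euclidean_space set \<Rightarrow> bool" where
  "bounded_domain \<Omega> \<longleftrightarrow> open \<Omega> \<and> connected \<Omega> \<and> bounded \<Omega> \<and> \<Omega> \<noteq> {} \<and>
     emeasure surface_measure (frontier \<Omega>) < \<infinity> \<and>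
     (AE x in surface_measure. x \<in> frontier \<Omega> \<longrightarrow> (\<exists>n. is_outward_normal \<Omega> x n))"


section \<open>Meshes\<close>

text \<open>\<open>G i\<close> is the set of grid coordinates in direction \<open>i\<close>; a cell is a closed box spanned
  in each direction by two consecutive grid coordinates.\<close>

definition cartesian_mesh :: "'a::euclidean_space set set \<Rightarrow> bool" where
  "cartesian_mesh \<T> \<longleftrightarrow> (\<exists>G :: 'a \<Rightarrow> real set. (\<forall>i\<in>Basis. finite (G i)) \<and>
     \<T> = {cbox a b | a b. \<forall>i\<in>Basis. a \<bullet> i \<in> G i \<and> b \<bullet> i \<in> G i \<and> a \<bullet> i < b \<bullet> i \<and>
                              (\<forall>g\<in>G i. \<not> (a \<bullet> i < g \<and> g < b \<bullet> i))})"

text \<open>Besides the domain and the background mesh, the discretisation fixes for each face \<open>F\<close>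
  which of the two adjacent cells is \<open>K\<^sup>+\<close> and which is \<open>K\<^sup>-\<close>, and a unit normal \<open>n\<^sub>F\<close>.\<close>

record 'a cut_mesh =
  domain :: "'a set"
  bg_mesh :: "'a set set"
  Kplus :: "'a set \<Rightarrow> 'a set"
  Kminus :: "'a set \<Rightarrow> 'a set"
  face_normal :: "'a set \<Rightarrow> 'a"

definition mesh_size :: "'a::euclidean_space cut_mesh \<Rightarrow> real" where
  "mesh_size M = Max (diameter ` bg_mesh M)"

definition active_mesh :: "'a::euclidean_space cut_mesh \<Rightarrow> 'a set set" where
  "active_mesh M = {K \<in> bg_mesh M. emeasure lborel (K \<inter> domain M) > 0}"

definition interior_cells :: "'a::euclidean_space cut_mesh \<Rightarrow> 'a set set" where
  "interior_cells M = {K \<in> active_mesh M. closure K \<subseteq> domain M}"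

definition cut_cells :: "'a::euclidean_space cut_mesh \<Rightarrow> 'a set set" where
  "cut_cells M = active_mesh M - interior_cells M"

definition interior_faces :: "'a::euclidean_space cut_mesh \<Rightarrow> 'a set set" where
  "interior_faces M = {frontier K \<inter> frontier K' | K K'.
     K \<in> active_mesh M \<and> K' \<in> active_mesh M \<and> K \<noteq> K' \<and>
     emeasure surface_measure (frontier K \<inter> frontier K') > 0}"

definition cut_faces :: "'a::euclidean_space cut_mesh \<Rightarrow> 'a set set" where
  "cut_faces M = {F \<inter> domain M | F.
     F \<in> interior_faces M \<and> emeasure surface_measure (F \<inter> domain M) > 0}"

definition ghost_faces :: "'a::euclidean_space cut_mesh \<Rightarrow> 'a set set" where
  "ghost_faces M = {F \<in> interior_faces M. Kplus M F \<in> cut_cells M \<or> Kminus M F \<in> cut_cells M}"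

definition valid_cut_mesh :: "'a::euclidean_space cut_mesh \<Rightarrow> bool" where
  "valid_cut_mesh M \<longleftrightarrow>
     bounded_domain (domain M) \<and>
     cartesian_mesh (bg_mesh M) \<and> domain M \<subseteq> \<Union> (bg_mesh M) \<and>
     (\<forall>F\<in>interior_faces M.
        Kplus M F \<in> active_mesh M \<and> Kminus M F \<in> active_mesh M \<and> Kplus M F \<noteq> Kminus M F \<and>
        F = frontier (Kplus M F) \<inter> frontier (Kminus M F) \<and>
        norm (face_normal M F) = 1 \<and> (\<forall>x\<in>F. \<forall>y\<in>F. (x - y) \<bullet> face_normal M F = 0))"


section \<open>Broken polynomial spaces\<close>

datatype poly_kind = Total_Degree | Tensor_Product

definition multi_indices :: "poly_kind \<Rightarrow> nat \<Rightarrow> ('a::euclidean_space \<Rightarrow> nat) set" where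
  "multi_indices k r = (case k of
     Total_Degree \<Rightarrow> {a \<in> Basis \<rightarrow>\<^sub>E UNIV. (\<Sum>i\<in>Basis. a i) \<le> r}
   | Tensor_Product \<Rightarrow> {a \<in> Basis \<rightarrow>\<^sub>E UNIV. \<forall>i\<in>Basis. a i \<le> r})"

definition poly_space :: "poly_kind \<Rightarrow> nat \<Rightarrow> ('a::euclidean_space \<Rightarrow> real) set" where
  "poly_space k r =
     {w. \<exists>c. w = (\<lambda>x. \<Sum>a\<in>multi_indices k r. c a * (\<Prod>i\<in>Basis. (x \<bullet> i) ^ a i))}"

text \<open>A discontinuous piecewise polynomial \<open>w\<close> is given by one polynomial \<open>w K\<close> per cell,
  regarded as a function on the whole space; its values on \<open>frontier K\<close> are the trace of
  \<open>w\<close> from \<open>K\<close>.\<close>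

type_synonym 'a broken = "'a set \<Rightarrow> 'a \<Rightarrow> real"

definition broken_space :: "'a::euclidean_space cut_mesh \<Rightarrow> poly_kind \<Rightarrow> nat \<Rightarrow> 'a broken set" where
  "broken_space M k r = {w. \<forall>K\<in>active_mesh M. w K \<in> poly_space k r}"

definition grad :: "('a::euclidean_space \<Rightarrow> real) \<Rightarrow> 'a \<Rightarrow> 'a" where
  "grad g x = (THE D. GDERIV g x :> D)"

definition dir_deriv :: "nat \<Rightarrow> 'a::euclidean_space \<Rightarrow> ('a \<Rightarrow> real) \<Rightarrow> 'a \<Rightarrow> real" where
  "dir_deriv l n g x = (deriv ^^ l) (\<lambda>s. g (x + s *\<^sub>R n)) 0"

definition time_deriv :: "(real \<Rightarrow> 'a broken) \<Rightarrow> real \<Rightarrow> 'a broken" where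
  "time_deriv w t = (\<lambda>K x. deriv (\<lambda>s. w s K x) t)"


section \<open>Jumps, ghost penalty and numerical fluxes\<close>

definition jump :: "'a::euclidean_space cut_mesh \<Rightarrow> 'a set \<Rightarrow> 'a broken \<Rightarrow> 'a \<Rightarrow> 'a" where
  "jump M F w x =
     w (Kplus M F) x *\<^sub>R outward_normal (Kplus M F) x +
     w (Kminus M F) x *\<^sub>R outward_normal (Kminus M F) x"

definition vector_jump ::
  "'a::euclidean_space cut_mesh \<Rightarrow> 'a set \<Rightarrow> ('a set \<Rightarrow> 'a \<Rightarrow> 'a) \<Rightarrow> 'a \<Rightarrow> real" where
  "vector_jump M F Q x =
     Q (Kplus M F) x \<bullet> outward_normal (Kplus M F) x +
     Q (Kminus M F) x \<bullet> outward_normal (Kminus M F) x"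

definition ghost_penalty ::
  "'a::euclidean_space cut_mesh \<Rightarrow> (nat \<Rightarrow> real) \<Rightarrow> nat \<Rightarrow> 'a broken \<Rightarrow> 'a broken \<Rightarrow> real" where
  "ghost_penalty M \<omega> r w z = (\<Sum>F\<in>ghost_faces M. \<Sum>l\<le>r.
     \<omega> l * mesh_size M ^ (2 * l + 1) / (real (2 * l + 1) * (fact l)\<^sup>2) *
     (LINT x:F|surface_measure.
        jump M F (\<lambda>K. dir_deriv l (face_normal M F) (w K)) x \<bullet>
        jump M F (\<lambda>K. dir_deriv l (face_normal M F) (z K)) x))"

text \<open>Two cut faces meet only in a set of surface measure zero, so that the face through a
  point of a cut face is unique almost everywhere.\<close>

definition face_at :: "'a::euclidean_space cut_mesh \<Rightarrow> 'a \<Rightarrow> 'a set" where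
  "face_at M x = (THE F. F \<in> interior_faces M \<and> F \<inter> domain M \<in> cut_faces M \<and> x \<in> F)"

text \<open>The fluxes on the boundary of \<open>K \<inter> domain M\<close>: the first case is that of the
  portions of the boundary of the domain, the second that of the cut faces.\<close>

definition flux_v ::
  "'a::euclidean_space cut_mesh \<Rightarrow> real \<Rightarrow> real \<Rightarrow> 'a broken \<Rightarrow> 'a broken \<Rightarrow> 'a \<Rightarrow> real" where
  "flux_v M \<alpha> \<tau> u v x =
     (if x \<in> frontier (domain M) then 0
      else let F = face_at M x in
        \<alpha> * v (Kplus M F) x + (1 - \<alpha>) * v (Kminus M F) x
        - \<tau> * vector_jump M F (\<lambda>K. grad (u K)) x)"

definition flux_grad_u ::
  "'a::euclidean_space cut_mesh \<Rightarrow> real \<Rightarrow> real \<Rightarrow> 'a broken \<Rightarrow> 'a broken \<Rightarrow> 'a set \<Rightarrow> 'a \<Rightarrow> 'a" where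
  "flux_grad_u M \<alpha> \<beta> u v K x =
     (if x \<in> frontier (domain M) then grad (u K) x
      else let F = face_at M x in
        (1 - \<alpha>) *\<^sub>R grad (u (Kplus M F)) x + \<alpha> *\<^sub>R grad (u (Kminus M F)) x
        - \<beta> *\<^sub>R jump M F v x)"


section \<open>The stabilised CutEDG scheme\<close>

definition cutedg_eq_u ::
  "'a::euclidean_space cut_mesh \<Rightarrow> nat \<Rightarrow> (nat \<Rightarrow> real) \<Rightarrow> real \<Rightarrow> real \<Rightarrow> real \<Rightarrow>
   'a broken \<Rightarrow> 'a broken \<Rightarrow> 'a broken \<Rightarrow> 'a broken \<Rightarrow> bool" where
  "cutedg_eq_u M p \<omega> \<alpha> \<tau> \<gamma>u u v ut \<phi> \<longleftrightarrow>
     (\<Sum>K\<in>active_mesh M. LINT x:K \<inter> domain M|lborel.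
         grad (\<phi> K) x \<bullet> grad (\<lambda>y. ut K y - v K y) x)
     + \<gamma>u / (mesh_size M)\<^sup>2 * ghost_penalty M \<omega> p ut \<phi>
   = (\<Sum>K\<in>active_mesh M. LINT x:frontier (K \<inter> domain M)|surface_measure.
         (flux_v M \<alpha> \<tau> u v x - v K x) * (grad (\<phi> K) x \<bullet> outward_normal (K \<inter> domain M) x))"

definition cutedg_eq_v ::
  "'a::euclidean_space cut_mesh \<Rightarrow> nat \<Rightarrow> (nat \<Rightarrow> real) \<Rightarrow> real \<Rightarrow> real \<Rightarrow> real \<Rightarrow> ('a \<Rightarrow> real) \<Rightarrow>
   'a broken \<Rightarrow> 'a broken \<Rightarrow> 'a broken \<Rightarrow> 'a broken \<Rightarrow> bool" where
  "cutedg_eq_v M q \<omega> \<alpha> \<beta> \<gamma>v f u v vt \<phi> \<longleftrightarrow>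
     (\<Sum>K\<in>active_mesh M. LINT x:K \<inter> domain M|lborel.
         \<phi> K x * vt K x + grad (\<phi> K) x \<bullet> grad (u K) x)
     + \<gamma>v * ghost_penalty M \<omega> q vt \<phi>
   = (\<Sum>K\<in>active_mesh M. LINT x:frontier (K \<inter> domain M)|surface_measure.
         \<phi> K x * (flux_grad_u M \<alpha> \<beta> u v K x \<bullet> outward_normal (K \<inter> domain M) x))
     + (\<Sum>K\<in>active_mesh M. LINT x:K \<inter> domain M|lborel. \<phi> K x * f x)"

definition cutedg_eq_const ::
  "'a::euclidean_space cut_mesh \<Rightarrow> nat \<Rightarrow> (nat \<Rightarrow> real) \<Rightarrow> real \<Rightarrow>
   'a broken \<Rightarrow> 'a broken \<Rightarrow> 'a broken \<Rightarrow> bool" where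
  "cutedg_eq_const M p \<omega> \<gamma>u v ut \<phi> \<longleftrightarrow>
     (\<Sum>K\<in>active_mesh M. LINT x:K \<inter> domain M|lborel.
         1 / (mesh_size M)\<^sup>2 * \<phi> K x * (ut K x - v K x))
     + \<gamma>u / (mesh_size M)\<^sup>2 * ghost_penalty M \<omega> p ut \<phi> = 0"

definition cutedg_solution ::
  "'a::euclidean_space cut_mesh \<Rightarrow> poly_kind \<Rightarrow> nat \<Rightarrow> nat \<Rightarrow> (nat \<Rightarrow> real) \<Rightarrow>
   real \<Rightarrow> real \<Rightarrow> real \<Rightarrow> real \<Rightarrow> real \<Rightarrow> (real \<Rightarrow> 'a \<Rightarrow> real) \<Rightarrow> real \<Rightarrow>
   (real \<Rightarrow> 'a broken) \<Rightarrow> (real \<Rightarrow> 'a broken) \<Rightarrow> bool" where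
  "cutedg_solution M k p q \<omega> \<alpha> \<tau> \<beta> \<gamma>u \<gamma>v f T u v \<longleftrightarrow> (\<forall>t\<in>{0<..<T}.
     u t \<in> broken_space M k p \<and> v t \<in> broken_space M k q \<and>
     (\<forall>K\<in>active_mesh M. \<forall>x. (\<lambda>s. u s K x) differentiable (at t)) \<and>
     (\<forall>K\<in>active_mesh M. \<forall>x. (\<lambda>s. v s K x) differentiable (at t)) \<and>
     (\<forall>\<phi>u\<in>broken_space M k p. \<forall>\<phi>v\<in>broken_space M k q. \<forall>\<phi>c\<in>broken_space M k 0.
        cutedg_eq_u M p \<omega> \<alpha> \<tau> \<gamma>u (u t) (v t) (time_deriv u t) \<phi>u \<and>
        cutedg_eq_v M q \<omega> \<alpha> \<beta> \<gamma>v (f t) (u t) (v t) (time_deriv v t) \<phi>v \<and>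
        cutedg_eq_const M p \<omega> \<gamma>u (v t) (time_deriv u t) \<phi>c))"

definition discrete_energy ::
  "'a::euclidean_space cut_mesh \<Rightarrow> 'a broken \<Rightarrow> 'a broken \<Rightarrow> real" where
  "discrete_energy M u v = 1 / 2 * (\<Sum>K\<in>active_mesh M. LINT x:K \<inter> domain M|lborel.
     (norm (grad (u K) x))\<^sup>2 + (v K x)\<^sup>2)"

end

theory Submission
  imports Defs
begin

text \<open>
  Test the first equation of the scheme with \<open>u\<close>, the second with \<open>v\<close>, and add. The
  volume integrands \<open>\<nabla>u \<bullet> \<nabla>(u\<^sub>t - v)\<close> and \<open>v v\<^sub>t + \<nabla>v \<bullet> \<nabla>u\<close> add up to
  \<open>\<nabla>u \<bullet> \<nabla>u\<^sub>t + v v\<^sub>t\<close> pointwise, so that the left-hand side is the time derivative of the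
  stabilised energy, and this derivative equals the sum over the cells of the boundary integrals of
  \<open>(w - v) \<nabla>u \<bullet> n + v g \<bullet> n\<close>, where \<open>w\<close> and \<open>g\<close> are the numerical fluxes for \<open>v\<close> and \<open>\<nabla>u\<close>. On
  the boundary of the domain \<open>w = 0\<close> and \<open>g = \<nabla>u\<close>, and the integrand vanishes. On an interior
  face the \<open>\<alpha>\<close>-weighted averages from the two sides cancel, which leaves \<open>- \<tau>\<close> times the squared
  jump of \<open>\<nabla>u\<close> minus \<open>\<beta>\<close> times the squared jump of \<open>v\<close> (\<open>flux_terms_cancel\<close>).

  Two points need an argument. The first is that the energy and the ghost penalty are
  differentiable: a trajectory in the broken space is only known to be differentiable pointwise in
  space. A polynomial space has a Lagrange basis on finitely many points
  (\<open>poly_space_interpolation\<close>), so the coefficients of the trajectory are point values, and all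
  energies become finite quadratic expressions in them
  (\<open>has_real_derivative_quadratic_trajectory\<close>).

  The second is the cancellation across the faces, where the flux is defined by means of the
  face through a point. If a cell has a normal at a point of its frontier in the domain, then
  the point lies inside one side of the cell and exactly two cells meet there, on opposite sides of a single face
  (\<open>face_at_neighbours\<close>). At all other points of a cell's frontier inside the domain, such as
  those on its edges, the normal is zero by convention and annihilates the flux. Therefore the
  sum over the cells of the boundary integrands is nonpositive at every point (\<open>boundary_terms_nonpos\<close>). For the sum of the integrals to be
  the integral of the sum, all terms have to be integrable: the normal of any set is a Borel
  function (\<open>borel_measurable_outward_normal\<close>), and the frontier of a cell has finite
  surface measure (\<open>hausdorff_outer_face_finite\<close>). For the common side of two cells to be a
  face of the mesh, it must have positive surface measure
  (\<open>hausdorff_outer_hyperplane_pos\<close>).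
\<close>


section \<open>Polynomials: gradients, directional derivatives, interpolation\<close>

text \<open>A property that holds for constants and coordinates and survives sums and products holds for
  all polynomials; existence of the gradient and the expansion along a line are of this kind.\<close>

lemma poly_space_closure_induct:
  assumes "w \<in> poly_space k r"
    and const: "\<And>c. Q (\<lambda>x. c)" and coord: "\<And>i. i \<in> Basis \<Longrightarrow> Q (\<lambda>x. x \<bullet> i)"
    and add: "\<And>f g. Q f \<Longrightarrow> Q g \<Longrightarrow> Q (\<lambda>x. f x + g x)"
    and mult: "\<And>f g. Q f \<Longrightarrow> Q g \<Longrightarrow> Q (\<lambda>x. f x * g x)"
  shows "Q w"
proof -
  have power: "Q (\<lambda>x. f x ^ n)" if "Q f" for f :: "'a \<Rightarrow> real" and n :: nat
  proof (induction n)
    case 0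
    show ?case using const[of 1] by simp
  next
    case (Suc n)
    show ?case using mult[OF that Suc] by simp
  qed
  have monomial: "Q (\<lambda>x. \<Prod>i\<in>B. (x \<bullet> i) ^ a i)" if "B \<subseteq> Basis" for a and B :: "'a set"
    using that
  proof (induction B rule: infinite_finite_induct)
    case (insert i B)
    then show ?case
      using mult[OF power[OF coord[of i]], of "\<lambda>x. \<Prod>i\<in>B. (x \<bullet> i) ^ a i" "a i"] by simp
  qed (use const[of 1] in simp_all)
  have "Q (\<lambda>x. \<Sum>a\<in>I. c a * (\<Prod>i\<in>Basis. (x \<bullet> i) ^ a i))" for c I
  proof (induction I rule: infinite_finite_induct)
    case (insert a I)
    then show ?case
      using add[OF mult[OF const[of "c a"] monomial[OF order_refl, of a]]] by simp
  qed (use const[of 0] in simp_all)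
  with assms(1) show ?thesis
    by (auto simp: poly_space_def)
qed

lemma poly_space_sum:
  assumes "\<And>j. j \<in> J \<Longrightarrow> L j \<in> poly_space k r"
  shows "(\<lambda>x. \<Sum>j\<in>J. d j * L j x) \<in> poly_space k r"
proof -
  obtain c where c: "\<And>j. j \<in> J \<Longrightarrow>
      L j = (\<lambda>x. \<Sum>a\<in>multi_indices k r. c j a * (\<Prod>i\<in>Basis. (x \<bullet> i) ^ a i))"
    using assms unfolding poly_space_def mem_Collect_eq by metis
  have "(\<lambda>x. \<Sum>j\<in>J. d j * L j x) =
      (\<lambda>x. \<Sum>a\<in>multi_indices k r. (\<Sum>j\<in>J. d j * c j a) * (\<Prod>i\<in>Basis. (x \<bullet> i) ^ a i))"
    by (rule ext, subst sum_distrib_right, subst sum.swap)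
      (auto intro!: sum.cong simp: c sum_distrib_left mult.assoc)
  then show ?thesis
    unfolding poly_space_def mem_Collect_eq
    by (intro exI[of _ "\<lambda>a. \<Sum>j\<in>J. d j * c j a"])
qed

lemma finite_multi_indices: "finite (multi_indices k r :: ('a::euclidean_space \<Rightarrow> nat) set)"
proof (rule finite_subset)
  have "a i \<le> r" if "(\<Sum>i\<in>Basis. a i) \<le> r" "i \<in> Basis" for a :: "'a \<Rightarrow> nat" and i
    using that member_le_sum[of i Basis a] by auto
  then show "multi_indices k r \<subseteq> (Basis \<rightarrow>\<^sub>E {..r} :: ('a \<Rightarrow> nat) set)"
    by (auto simp: multi_indices_def PiE_def split: poly_kind.splits)
  show "finite (Basis \<rightarrow>\<^sub>E {..r} :: ('a \<Rightarrow> nat) set)"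
    by (intro finite_PiE) auto
qed

lemma grad_eqI:
  assumes "GDERIV w x :> D"
  shows "grad w x = D"
  unfolding grad_def
proof (rule the_equality)
  fix D' assume "GDERIV w x :> D'"
  with assms have "(\<lambda>h. inner h D') = (\<lambda>h. inner h D)"
    unfolding gderiv_def by (rule has_derivative_unique[rotated])
  then have "h \<bullet> D' = h \<bullet> D" for h
    by (rule fun_cong)
  then show "D' = D"
    using vector_eq_ldot[of D' D] by blast
qed (rule assms)

lemma GDERIV_grad_poly:
  assumes "w \<in> poly_space k r"
  shows "GDERIV w x :> grad w x" and "continuous_on UNIV (grad w)"
proof -
  have "\<exists>D. (\<forall>x. GDERIV w x :> D x) \<and> continuous_on UNIV D" (is "?Q w")
  proof (rule poly_space_closure_induct[OF assms, of ?Q])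
    fix c :: real
    show "?Q (\<lambda>x. c)"
      by (rule exI[of _ "\<lambda>x. 0"]) (simp add: GDERIV_const)
  next
    fix i :: 'a
    have "GDERIV (\<lambda>x. x \<bullet> i) x :> i" for x
      unfolding gderiv_def by (auto intro!: derivative_eq_intros)
    then show "?Q (\<lambda>x. x \<bullet> i)" by (intro exI[of _ "\<lambda>x. i"]) simp
  next
    fix f g :: "'a \<Rightarrow> real"
    assume "?Q f" "?Q g"
    then obtain D D' where D: "\<And>x. GDERIV f x :> D x" "continuous_on UNIV D"
      "\<And>x. GDERIV g x :> D' x" "continuous_on UNIV D'" by blast
    have cont: "continuous_on UNIV f" "continuous_on UNIV g"
      using D(1,3) unfolding gderiv_def continuous_on_eq_continuous_at[OF open_UNIV]
      by (auto intro: has_derivative_continuous)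
    show "?Q (\<lambda>x. f x + g x)"
      using GDERIV_add[OF D(1,3)] continuous_on_add[OF D(2,4)]
      by (intro exI[of _ "\<lambda>x. D x + D' x"]) blast
    show "?Q (\<lambda>x. f x * g x)"
      using GDERIV_mult[OF D(1,3)]
        continuous_on_add[OF continuous_on_scaleR[OF cont(1) D(4)] continuous_on_scaleR[OF cont(2) D(2)]]
      by (intro exI[of _ "\<lambda>x. f x *\<^sub>R D' x + g x *\<^sub>R D x"]) blast
  qed
  then obtain D where D: "\<And>x. GDERIV w x :> D x" "continuous_on UNIV D" by blast
  have "grad w x = D x" for x
    using D(1) by (rule grad_eqI)
  then have "grad w = D" by (rule ext)
  with D show "GDERIV w x :> grad w x" "continuous_on UNIV (grad w)"
    by simp_all
qed



lemma grad_linear_combination: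
  assumes "\<And>j. j \<in> J \<Longrightarrow> L j \<in> poly_space k r"
  shows "grad (\<lambda>x. \<Sum>j\<in>J. d j * L j x) x = (\<Sum>j\<in>J. d j *\<^sub>R grad (L j) x)"
proof (rule grad_eqI)
  show "GDERIV (\<lambda>x. \<Sum>j\<in>J. d j * L j x) x :> (\<Sum>j\<in>J. d j *\<^sub>R grad (L j) x)"
    unfolding gderiv_def inner_sum_right inner_scaleR_right
    by (intro has_derivative_sum has_derivative_mult_right
        GDERIV_grad_poly(1)[unfolded gderiv_def, OF assms])
qed

lemma grad_diff_poly:
  assumes "f \<in> poly_space k r" "g \<in> poly_space k s"
  shows "grad (\<lambda>x. f x - g x) x = grad f x - grad g x"
  by (intro grad_eqI GDERIV_diff GDERIV_grad_poly(1)[OF assms(1)] GDERIV_grad_poly(1)[OF assms(2)])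

lemma continuous_on_poly_space:
  assumes "w \<in> poly_space k r"
  shows "continuous_on UNIV w"
  using GDERIV_grad_poly(1)[OF assms] unfolding gderiv_def continuous_on_eq_continuous_at[OF open_UNIV]
  by (auto intro: has_derivative_continuous)

text \<open>On every line a polynomial is a univariate polynomial of the parameter, whose coefficients
  depend continuously on the base point; the directional derivatives are its Taylor coefficients.\<close>

lemma poly_space_along_line:
  assumes "w \<in> poly_space k r"
  obtains P where "\<And>x. (\<lambda>s. w (x + s *\<^sub>R n)) = poly (P x)"
    and "\<And>l. continuous_on UNIV (\<lambda>x. coeff (P x) l)"
proof -
  have "\<exists>P. (\<forall>x s. w (x + s *\<^sub>R n) = poly (P x) s) \<and> (\<forall>l. continuous_on UNIV (\<lambda>x. coeff (P x) l))"
    (is "?Q w")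
  proof (rule poly_space_closure_induct[OF assms, of ?Q])
    fix c :: real
    show "?Q (\<lambda>x. c)"
      by (rule exI[of _ "\<lambda>x. [:c:]"]) simp
  next
    fix i :: 'a
    have "continuous_on UNIV (\<lambda>x. coeff [:x \<bullet> i, n \<bullet> i:] l)" for l
    proof (cases l)
      case (Suc l')
      then show ?thesis by (cases l') auto
    qed (auto intro!: continuous_intros)
    then show "?Q (\<lambda>x. x \<bullet> i)"
      by (intro exI[of _ "\<lambda>x. [:x \<bullet> i, n \<bullet> i:]"]) (simp add: inner_add_left)
  next
    fix f g :: "'a \<Rightarrow> real"
    assume "?Q f" "?Q g"
    then obtain P P' where P: "\<And>x s. f (x + s *\<^sub>R n) = poly (P x) s"
      "\<And>l. continuous_on UNIV (\<lambda>x. coeff (P x) l)"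
      "\<And>x s. g (x + s *\<^sub>R n) = poly (P' x) s" "\<And>l. continuous_on UNIV (\<lambda>x. coeff (P' x) l)"
      by metis
    show "?Q (\<lambda>x. f x + g x)"
      by (rule exI[of _ "\<lambda>x. P x + P' x"]) (simp add: P continuous_on_add)
    show "?Q (\<lambda>x. f x * g x)"
      by (rule exI[of _ "\<lambda>x. P x * P' x"])
        (simp add: P coeff_mult continuous_on_sum continuous_on_mult)
  qed
  then obtain P where "\<And>x s. w (x + s *\<^sub>R n) = poly (P x) s"
    "\<And>l. continuous_on UNIV (\<lambda>x. coeff (P x) l)" by blast
  then show ?thesis by (intro that[of P] ext)
qed

lemma funpow_deriv_poly: "(deriv ^^ l) (poly p) = poly ((pderiv ^^ l) p)" for p :: "real poly"
proof (induction l)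
  case (Suc l)
  have "deriv (poly q) = poly (pderiv q)" for q :: "real poly"
    by (intro ext DERIV_imp_deriv poly_DERIV)
  with Suc show ?case by simp
qed simp

lemma dir_deriv_eq_coeff:
  assumes "(\<lambda>s. w (x + s *\<^sub>R n)) = poly p"
  shows "dir_deriv l n w x = pochhammer 1 l * coeff p l"
  by (simp add: dir_deriv_def assms funpow_deriv_poly poly_0_coeff_0 coeff_higher_pderiv)

lemma continuous_on_dir_deriv:
  assumes "w \<in> poly_space k r"
  shows "continuous_on UNIV (dir_deriv l n w)"
proof -
  obtain P where P: "\<And>x. (\<lambda>s. w (x + s *\<^sub>R n)) = poly (P x)"
    "\<And>l. continuous_on UNIV (\<lambda>x. coeff (P x) l)"
    using poly_space_along_line[OF assms] by blast
  have "dir_deriv l n w = (\<lambda>x. pochhammer 1 l * coeff (P x) l)"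
    by (rule ext) (rule dir_deriv_eq_coeff[OF P(1)])
  then show ?thesis by (simp add: P(2) continuous_on_mult_left)
qed

lemma dir_deriv_linear_combination:
  assumes "\<And>j. j \<in> J \<Longrightarrow> L j \<in> poly_space k r"
  shows "dir_deriv l n (\<lambda>x. \<Sum>j\<in>J. d j * L j x) x = (\<Sum>j\<in>J. d j * dir_deriv l n (L j) x)"
proof -
  have "\<exists>p. (\<lambda>s. L j (x + s *\<^sub>R n)) = poly p" if "j \<in> J" for j
    using poly_space_along_line[OF assms[OF that]] by metis
  then obtain p where p: "\<And>j. j \<in> J \<Longrightarrow> (\<lambda>s. L j (x + s *\<^sub>R n)) = poly (p j)"
    by metis
  have "(\<lambda>s. \<Sum>j\<in>J. d j * L j (x + s *\<^sub>R n)) = poly (\<Sum>j\<in>J. smult (d j) (p j))"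
    by (rule ext) (auto simp: poly_sum intro!: sum.cong dest: p[THEN fun_cong])
  from dir_deriv_eq_coeff[where w = "\<lambda>x. \<Sum>j\<in>J. d j * L j x", OF this] show ?thesis
    by (auto simp: coeff_sum sum_distrib_left mult_ac dir_deriv_eq_coeff[OF p] intro!: sum.cong)
qed

text \<open>A finite-dimensional space of functions is unisolvent on suitable points: whenever a further
  function differs from its interpolant, a point where it does so can be added.\<close>

lemma lagrange_basis_exists:
  fixes m :: "'i \<Rightarrow> 'a \<Rightarrow> real"
  assumes "finite I"
  shows "\<exists>X L. finite X \<and> (\<forall>y\<in>X. \<exists>c. L y = (\<lambda>x. \<Sum>a\<in>I. c a * m a x)) \<and>
    (\<forall>y\<in>X. \<forall>z\<in>X. L y z = (if y = z then 1 else 0)) \<and>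
    (\<forall>a\<in>I. \<forall>z. m a z = (\<Sum>y\<in>X. m a y * L y z))"
  using assms
proof (induction I)
  case empty
  show ?case by (intro exI[of _ "{}"]) simp
next
  case (insert b I)
  obtain X L where X: "finite X" and span: "\<forall>y\<in>X. \<exists>c. L y = (\<lambda>x. \<Sum>a\<in>I. c a * m a x)"
    and delta': "\<forall>y\<in>X. \<forall>z\<in>X. L y z = (if y = z then 1 else 0)"
    and repr': "\<forall>a\<in>I. \<forall>z. m a z = (\<Sum>y\<in>X. m a y * L y z)"
    using insert.IH by (elim exE conjE) (rule that)
  note delta = delta'[rule_format] and repr = repr'[rule_format]
  obtain c where c: "\<And>y. y \<in> X \<Longrightarrow> L y = (\<lambda>x. \<Sum>a\<in>I. c y a * m a x)"
    using bchoice[OF span] by (elim exE) (rule that, simp)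
  \<comment> \<open>the interpolation error of the new function\<close>
  define g where "g z = m b z - (\<Sum>y\<in>X. m b y * L y z)" for z
  have span': "\<exists>c'. (\<lambda>x. e * m b x + (\<Sum>y\<in>X. d y * L y x)) = (\<lambda>x. \<Sum>a\<in>insert b I. c' a * m a x)" for d e
  proof (intro exI ext)
    fix x
    have "(\<Sum>y\<in>X. d y * L y x) = (\<Sum>a\<in>I. (\<Sum>y\<in>X. d y * c y a) * m a x)"
      by (subst sum_distrib_right, subst sum.swap)
        (auto intro!: sum.cong simp: c sum_distrib_left mult.assoc)
    also have "\<dots> = (\<Sum>a\<in>I. (if a = b then e else (\<Sum>y\<in>X. d y * c y a)) * m a x)"
      using insert.hyps by (intro sum.cong) auto
    finally show "e * m b x + (\<Sum>y\<in>X. d y * L y x) =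
        (\<Sum>a\<in>insert b I. (if a = b then e else (\<Sum>y\<in>X. d y * c y a)) * m a x)"
      using insert.hyps by simp
  qed
  show ?case
  proof (cases "\<forall>z. g z = 0")
    case True
    have "\<exists>c'. L y = (\<lambda>x. \<Sum>a\<in>insert b I. c' a * m a x)" if "y \<in> X" for y
      using span'[of 0 "\<lambda>z. if z = y then 1 else 0"] that X by (simp add: if_distrib[of "\<lambda>z. z * _"] cong: if_cong)
    moreover have "m a z = (\<Sum>y\<in>X. m a y * L y z)" if "a \<in> insert b I" for a z
      using that True repr by (auto simp: g_def)
    ultimately show ?thesis
      using X delta by (intro exI[of _ X] exI[of _ L] conjI ballI allI)
  next
    case False
    then obtain x0 where x0: "g x0 \<noteq> 0" by blast
    have g0: "g z = 0" if "z \<in> X" for z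
      using that X by (simp add: g_def delta if_distrib[of "\<lambda>z. _ * z"] cong: if_cong)
    with x0 have "x0 \<notin> X" by blast
    \<comment> \<open>Since \<open>g\<close> vanishes on \<open>X\<close>, its normalisation is a Lagrange function for \<open>x0\<close>; the
      old Lagrange functions are corrected by multiples of it so as to vanish at \<open>x0\<close>.\<close>
    define L0 where "L0 z = g z / g x0" for z
    define L' where "L' y = (if y = x0 then L0 else (\<lambda>z. L y z - L y x0 * L0 z))" for y
    have L0: "L0 x0 = 1" "\<And>z. z \<in> X \<Longrightarrow> L0 z = 0"
      using x0 g0 by (auto simp: L0_def)
    \<comment> \<open>the interpolant of a function splits into the old one and a correction at \<open>x0\<close>\<close>
    have interp: "(\<Sum>y\<in>insert x0 X. f y * L' y z) =
        (\<Sum>y\<in>X. f y * L y z) + (f x0 - (\<Sum>y\<in>X. f y * L y x0)) * L0 z" for f z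
    proof -
      have "(\<Sum>y\<in>X. f y * L' y z) = (\<Sum>y\<in>X. f y * L y z - f y * L y x0 * L0 z)"
        using \<open>x0 \<notin> X\<close> by (intro sum.cong) (auto simp: L'_def algebra_simps)
      also have "\<dots> = (\<Sum>y\<in>X. f y * L y z) - (\<Sum>y\<in>X. f y * L y x0) * L0 z"
        by (simp add: sum_subtractf sum_distrib_right)
      moreover have "L' x0 z = L0 z" by (simp add: L'_def)
      ultimately show ?thesis
        using X \<open>x0 \<notin> X\<close> by (simp add: left_diff_distrib)
    qed
    have spanL0: "L0 = (\<lambda>x. (1 / g x0) * m b x + (\<Sum>y\<in>X. (- m b y / g x0) * L y x))"
      by (rule ext) (simp add: L0_def g_def diff_divide_distrib sum_divide_distrib sum_negf)
    have "\<exists>c'. L' y = (\<lambda>x. \<Sum>a\<in>insert b I. c' a * m a x)" if "y \<in> insert x0 X" for y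
    proof (cases "y = x0")
      case True
      then have "L' y = L0" by (simp add: L'_def)
      then show ?thesis unfolding spanL0 by (simp only: span')
    next
      case False
      have "L' y = (\<lambda>x. (- L y x0 / g x0) * m b x +
          (\<Sum>z\<in>X. ((if z = y then 1 else 0) + L y x0 / g x0 * m b z) * L z x))"
      proof
        fix x
        have "(\<Sum>z\<in>X. ((if z = y then 1 else 0) + L y x0 / g x0 * m b z) * L z x) =
            (\<Sum>z\<in>X. if z = y then L z x else 0) + L y x0 / g x0 * (\<Sum>z\<in>X. m b z * L z x)"
          unfolding sum_distrib_left sum.distrib[symmetric] by (intro sum.cong) (auto simp: distrib_right)
        also have "(\<Sum>z\<in>X. if z = y then L z x else 0) = L y x"
          using False that X by simp
        finally show "L' y x = (- L y x0 / g x0) * m b x +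
            (\<Sum>z\<in>X. ((if z = y then 1 else 0) + L y x0 / g x0 * m b z) * L z x)"
          using False x0 by (simp add: L'_def L0_def g_def[of x] field_simps)
      qed
      then show ?thesis by (simp only: span')
    qed
    moreover have "m a z = (\<Sum>y\<in>insert x0 X. m a y * L' y z)" if "a \<in> insert b I" for a z
    proof (cases "a = b")
      case True
      have "g z = g x0 * L0 z" using x0 by (simp add: L0_def)
      then show ?thesis unfolding interp True g_def by simp
    next
      case False
      then show ?thesis unfolding interp using that repr[of a z] repr[of a x0] by simp
    qed
    moreover have "L' y z = (if y = z then 1 else 0)" if "y \<in> insert x0 X" "z \<in> insert x0 X" for y z
      using that L0 delta \<open>x0 \<notin> X\<close> by (auto simp: L'_def)
    moreover have "finite (insert x0 X)" using X by simp
    ultimately show ?thesis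
      by (intro exI[of _ "insert x0 X"] exI[of _ L'] conjI ballI allI)
  qed
qed

text \<open>This turns the values of a polynomial at finitely many points into its coefficients, so that
  whatever is known pointwise about a family of polynomials transfers to the coefficients.\<close>

lemma poly_space_interpolation:
  obtains X :: "'a::euclidean_space set" and L where "finite X" "\<And>y. y \<in> X \<Longrightarrow> L y \<in> poly_space k r"
    and "\<And>w. w \<in> poly_space k r \<Longrightarrow> w = (\<lambda>z. \<Sum>y\<in>X. w y * L y z)"
proof -
  let ?m = "\<lambda>a x. \<Prod>i\<in>Basis. (x \<bullet> i) ^ a i :: real"
  obtain X :: "'a set" and L where X: "finite X"
    and L: "\<forall>y\<in>X. \<exists>c. L y = (\<lambda>x. \<Sum>a\<in>multi_indices k r. c a * ?m a x)"
    and repr: "\<forall>a\<in>multi_indices k r. \<forall>z. ?m a z = (\<Sum>y\<in>X. ?m a y * L y z)"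
    using lagrange_basis_exists[OF finite_multi_indices[of k r], of ?m] by (elim exE conjE) (rule that)
  show ?thesis
  proof (rule that[OF X])
    fix w :: "'a \<Rightarrow> real" assume "w \<in> poly_space k r"
    then obtain c where w: "w = (\<lambda>x. \<Sum>a\<in>multi_indices k r. c a * ?m a x)"
      by (auto simp: poly_space_def)
    show "w = (\<lambda>z. \<Sum>y\<in>X. w y * L y z)"
    proof
      fix z
      have "w z = (\<Sum>a\<in>multi_indices k r. \<Sum>y\<in>X. c a * (?m a y * L y z))"
        unfolding w sum_distrib_left[symmetric] using repr by (intro sum.cong) simp_all
      also have "\<dots> = (\<Sum>y\<in>X. w y * L y z)"
        unfolding w sum_distrib_right by (subst sum.swap) (simp add: mult.assoc)
      finally show "w z = (\<Sum>y\<in>X. w y * L y z)" .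
    qed
  qed (use L in \<open>auto simp: poly_space_def\<close>)
qed


section \<open>Borel functions that are bounded on bounded sets\<close>

text \<open>A class of integrands that contains the traces of polynomials as well as the normals, is closed
  under the pointwise operations from which the fluxes are built, and is integrable over bounded sets of
  finite measure.\<close>

definition bounded_borel :: "('a::euclidean_space \<Rightarrow> 'b::euclidean_space) \<Rightarrow> bool" where
  "bounded_borel f \<longleftrightarrow> f \<in> borel_measurable borel \<and> (\<forall>S. bounded S \<longrightarrow> bounded (f ` S))"

lemma bounded_borelI:
  assumes "f \<in> borel_measurable borel" "\<And>S. bounded S \<Longrightarrow> \<exists>c. \<forall>x\<in>S. norm (f x) \<le> c"
  shows "bounded_borel f"
  using assms by (auto simp: bounded_borel_def bounded_iff)

lemma bounded_borelD:
  assumes "bounded_borel f"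
  shows "f \<in> borel_measurable borel" "bounded S \<Longrightarrow> \<exists>c\<ge>0. \<forall>x\<in>S. norm (f x) \<le> c"
proof -
  show "f \<in> borel_measurable borel" using assms by (simp add: bounded_borel_def)
  assume "bounded S"
  then have "bounded (f ` S)" using assms by (simp add: bounded_borel_def)
  then show "\<exists>c\<ge>0. \<forall>x\<in>S. norm (f x) \<le> c" by (auto simp: bounded_pos intro: less_imp_le)
qed

lemma set_integrable_bounded_borel:
  fixes f :: "'a::euclidean_space \<Rightarrow> 'b::euclidean_space"
  assumes "sets \<mu> = sets borel" "S \<in> sets borel" "bounded S" "emeasure \<mu> S < \<infinity>" "bounded_borel f"
  shows "set_integrable \<mu> S f"
proof -
  obtain B where "\<forall>x\<in>S. norm (f x) \<le> B"
    using bounded_borelD(2)[OF assms(5,3)] by blast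
  moreover have "f \<in> borel_measurable \<mu>"
    using bounded_borelD(1)[OF assms(5)] assms(1) by (simp cong: measurable_cong_sets)
  ultimately show ?thesis
    unfolding set_integrable_def
    using assms by (intro integrableI_bounded_set_indicator[of _ _ _ B]) auto
qed

lemma bounded_image_continuous:
  fixes f :: "'a::euclidean_space \<Rightarrow> 'b::euclidean_space"
  assumes "continuous_on UNIV f" "bounded S"
  shows "bounded (f ` S)"
proof -
  have "compact (f ` closure S)"
    using assms by (intro compact_continuous_image continuous_on_subset[OF assms(1)]) auto
  then show ?thesis
    using closure_subset by (blast intro: bounded_subset compact_imp_bounded)
qed

lemma bounded_borel_continuous: "continuous_on UNIV f \<Longrightarrow> bounded_borel f"
  by (simp add: bounded_borel_def borel_measurable_continuous_onI bounded_image_continuous)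

lemma bounded_borel_add:
  assumes f: "bounded_borel f" and g: "bounded_borel g"
  shows "bounded_borel (\<lambda>x. f x + g x)"
proof (rule bounded_borelI)
  show "(\<lambda>x. f x + g x) \<in> borel_measurable borel"
    using bounded_borelD(1)[OF f] bounded_borelD(1)[OF g] by measurable
  fix S :: "'a set" assume S: "bounded S"
  obtain b c where "\<forall>x\<in>S. norm (f x) \<le> b" "\<forall>x\<in>S. norm (g x) \<le> c"
    using bounded_borelD(2)[OF f S] bounded_borelD(2)[OF g S] by blast
  then have "\<forall>x\<in>S. norm (f x + g x) \<le> b + c"
    by (auto intro!: norm_triangle_le add_mono)
  then show "\<exists>c. \<forall>x\<in>S. norm (f x + g x) \<le> c" ..
qed

lemma bounded_borel_scaleR:
  assumes f: "bounded_borel f" and g: "bounded_borel g"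
  shows "bounded_borel (\<lambda>x. f x *\<^sub>R g x)"
proof (rule bounded_borelI)
  show "(\<lambda>x. f x *\<^sub>R g x) \<in> borel_measurable borel"
    using bounded_borelD(1)[OF f] bounded_borelD(1)[OF g] by measurable
  fix S :: "'a set" assume S: "bounded S"
  obtain b c where "0 \<le> b" "\<forall>x\<in>S. norm (f x) \<le> b" "\<forall>x\<in>S. norm (g x) \<le> c"
    using bounded_borelD(2)[OF f S] bounded_borelD(2)[OF g S] by blast
  then have "\<forall>x\<in>S. norm (f x *\<^sub>R g x) \<le> b * c"
    by (auto intro!: mult_mono)
  then show "\<exists>c. \<forall>x\<in>S. norm (f x *\<^sub>R g x) \<le> c" ..
qed

lemma bounded_borel_inner:
  assumes f: "bounded_borel f" and g: "bounded_borel g"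
  shows "bounded_borel (\<lambda>x. f x \<bullet> g x)"
proof (rule bounded_borelI)
  show "(\<lambda>x. f x \<bullet> g x) \<in> borel_measurable borel"
    using bounded_borelD(1)[OF f] bounded_borelD(1)[OF g] by measurable
  fix S :: "'a set" assume S: "bounded S"
  obtain b c where "0 \<le> b" "\<forall>x\<in>S. norm (f x) \<le> b" "\<forall>x\<in>S. norm (g x) \<le> c"
    using bounded_borelD(2)[OF f S] bounded_borelD(2)[OF g S] by blast
  then have "\<forall>x\<in>S. norm (f x \<bullet> g x) \<le> b * c"
    unfolding real_norm_def by (auto intro!: order_trans[OF Cauchy_Schwarz_ineq2] mult_mono)
  then show "\<exists>c. \<forall>x\<in>S. norm (f x \<bullet> g x) \<le> c" ..
qed

lemma bounded_borel_const: "bounded_borel (\<lambda>x. c)"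
  by (intro bounded_borel_continuous continuous_on_const)

lemma bounded_borel_diff:
  assumes "bounded_borel f" "bounded_borel g"
  shows "bounded_borel (\<lambda>x. f x - g x)"
  using bounded_borel_add[OF assms(1) bounded_borel_scaleR[OF bounded_borel_const[of "-1"] assms(2)]]
  by simp

lemma bounded_borel_mult:
  "bounded_borel f \<Longrightarrow> bounded_borel g \<Longrightarrow> bounded_borel (\<lambda>x. f x * g x :: real)"
  using bounded_borel_scaleR[of f g] by simp

lemma bounded_borel_indicator:
  assumes "A \<in> sets borel"
  shows "bounded_borel (indicator A :: _ \<Rightarrow> real)"
  using assms by (intro bounded_borelI exI[of _ 1]) (auto simp: indicator_def)

lemma set_integrable_continuous_bounded:
  fixes f :: "'a::euclidean_space \<Rightarrow> 'b::euclidean_space"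
  assumes "S \<in> sets borel" "bounded S" "continuous_on UNIV f"
  shows "set_integrable lborel S f"
  using assms
  by (intro set_integrable_bounded_borel bounded_borel_continuous emeasure_bounded_finite) auto


section \<open>Time derivatives of quadratic integrals\<close>

lemma set_integral_inner_sums:
  fixes G H :: "'i \<Rightarrow> 'x \<Rightarrow> 'b::euclidean_space"
  assumes "\<And>i j. i \<in> I \<Longrightarrow> j \<in> I \<Longrightarrow> set_integrable \<mu> S (\<lambda>x. G i x \<bullet> H j x)"
  shows "(LINT x:S|\<mu>. (\<Sum>i\<in>I. c i *\<^sub>R G i x) \<bullet> (\<Sum>j\<in>I. d j *\<^sub>R H j x)) =
    (\<Sum>i\<in>I. \<Sum>j\<in>I. c i * d j * (LINT x:S|\<mu>. G i x \<bullet> H j x))"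
proof -
  have int: "integrable \<mu> (\<lambda>x. indicator S x * (G i x \<bullet> H j x))" if "i \<in> I" "j \<in> I" for i j
    using assms[OF that] by (simp add: set_integrable_def)
  have "(LINT x:S|\<mu>. (\<Sum>i\<in>I. c i *\<^sub>R G i x) \<bullet> (\<Sum>j\<in>I. d j *\<^sub>R H j x)) =
      (LINT x|\<mu>. (\<Sum>i\<in>I. \<Sum>j\<in>I. c i * d j * (indicator S x * (G i x \<bullet> H j x))))"
    unfolding set_lebesgue_integral_def
    by (intro Bochner_Integration.integral_cong refl, unfold inner_sum_left,
        unfold inner_sum_right) (simp add: sum_distrib_left mult_ac)
  also have "\<dots> = (\<Sum>i\<in>I. LINT x|\<mu>. (\<Sum>j\<in>I. c i * d j * (indicator S x * (G i x \<bullet> H j x))))"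
    by (intro Bochner_Integration.integral_sum Bochner_Integration.integrable_sum
        integrable_mult_right int)
  also have "\<dots> = (\<Sum>i\<in>I. \<Sum>j\<in>I. LINT x|\<mu>. c i * d j * (indicator S x * (G i x \<bullet> H j x)))"
    by (intro sum.cong refl Bochner_Integration.integral_sum integrable_mult_right int)
  also have "\<dots> = (\<Sum>i\<in>I. \<Sum>j\<in>I. c i * d j * (LINT x:S|\<mu>. G i x \<bullet> H j x))"
    by (simp add: set_lebesgue_integral_def)
  finally show ?thesis .
qed

text \<open>By bilinearity the integral of the square is a quadratic form in the coefficients with constant
  Gram matrix, and only finitely many products of coefficients have to be differentiated.\<close>

lemma has_real_derivative_set_integral_square:
  fixes G :: "'i \<Rightarrow> 'x \<Rightarrow> 'b::euclidean_space"
  assumes int: "\<And>i j. i \<in> I \<Longrightarrow> j \<in> I \<Longrightarrow> set_integrable \<mu> S (\<lambda>x. G i x \<bullet> G j x)"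
    and deriv: "\<And>i. i \<in> I \<Longrightarrow> (c i has_real_derivative c' i) (at t)"
    and "open U" "t \<in> U" and W: "\<And>s x. s \<in> U \<Longrightarrow> W s x = (\<Sum>i\<in>I. c i s *\<^sub>R G i x)"
    and W': "\<And>x. W' x = (\<Sum>i\<in>I. c' i *\<^sub>R G i x)"
  shows "((\<lambda>s. LINT x:S|\<mu>. W s x \<bullet> W s x) has_real_derivative 2 * (LINT x:S|\<mu>. W' x \<bullet> W t x)) (at t)"
proof (rule DERIV_cong)
  let ?g = "\<lambda>i j. LINT x:S|\<mu>. G i x \<bullet> G j x"
  have "((\<lambda>s. \<Sum>i\<in>I. \<Sum>j\<in>I. c i s * c j s * ?g i j) has_real_derivative
      (\<Sum>i\<in>I. \<Sum>j\<in>I. (c' i * c j t + c' j * c i t) * ?g i j)) (at t)"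
    by (intro DERIV_sum DERIV_cmult_right DERIV_mult deriv)
  then show "((\<lambda>s. LINT x:S|\<mu>. W s x \<bullet> W s x) has_real_derivative
      (\<Sum>i\<in>I. \<Sum>j\<in>I. (c' i * c j t + c' j * c i t) * ?g i j)) (at t)"
  proof (rule has_field_derivative_transform_within_open[OF _ \<open>open U\<close> \<open>t \<in> U\<close>])
    fix s assume "s \<in> U"
    then show "(\<Sum>i\<in>I. \<Sum>j\<in>I. c i s * c j s * ?g i j) = (LINT x:S|\<mu>. W s x \<bullet> W s x)"
      by (simp add: W set_integral_inner_sums int)
  qed
  \<comment> \<open>symmetry of the Gram matrix\<close>
  have "(\<Sum>i\<in>I. \<Sum>j\<in>I. c' j * c i t * ?g i j) = (\<Sum>i\<in>I. \<Sum>j\<in>I. c' i * c j t * ?g i j)"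
    by (subst sum.swap) (simp add: inner_commute)
  then show "(\<Sum>i\<in>I. \<Sum>j\<in>I. (c' i * c j t + c' j * c i t) * ?g i j) = 2 * (LINT x:S|\<mu>. W' x \<bullet> W t x)"
    using \<open>t \<in> U\<close> by (simp add: W W' set_integral_inner_sums int distrib_right sum.distrib)
qed

lemma time_deriv_broken_space:
  fixes w :: "real \<Rightarrow> 'a::euclidean_space broken"
  assumes "open U" "t \<in> U" and space: "\<And>s. s \<in> U \<Longrightarrow> w s \<in> broken_space M k r"
    and diff: "\<And>K x. K \<in> active_mesh M \<Longrightarrow> (\<lambda>s. w s K x) differentiable (at t)"
  shows "time_deriv w t \<in> broken_space M k r"
  unfolding broken_space_def
proof (intro CollectI ballI)
  fix K assume K: "K \<in> active_mesh M"
  obtain X :: "'a set" and L where XL: "finite X" "\<And>y. y \<in> X \<Longrightarrow> L y \<in> poly_space k r"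
    "\<And>f. f \<in> poly_space k r \<Longrightarrow> f = (\<lambda>z. \<Sum>y\<in>X. f y * L y z)"
    by (rule poly_space_interpolation[of k r]) (rule that)
  have "((\<lambda>s. w s K x) has_real_derivative (\<Sum>y\<in>X. time_deriv w t K y * L y x)) (at t)" for x
  proof (rule has_field_derivative_transform_within_open[OF _ \<open>open U\<close> \<open>t \<in> U\<close>])
    show "((\<lambda>s. \<Sum>y\<in>X. w s K y * L y x) has_real_derivative (\<Sum>y\<in>X. time_deriv w t K y * L y x)) (at t)"
      unfolding time_deriv_def
      by (intro DERIV_sum DERIV_cmult_right) (use diff[OF K] in \<open>simp add: DERIV_deriv_iff_real_differentiable\<close>)
    fix s assume "s \<in> U"
    then have "w s K \<in> poly_space k r"
      using space K by (simp add: broken_space_def)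
    from XL(3)[OF this, THEN fun_cong, of x] show "(\<Sum>y\<in>X. w s K y * L y x) = w s K x" ..
  qed
  then have "time_deriv w t K = (\<lambda>x. \<Sum>y\<in>X. time_deriv w t K y * L y x)"
    by (intro ext) (subst time_deriv_def, rule DERIV_imp_deriv)
  moreover have "(\<lambda>x. \<Sum>y\<in>X. time_deriv w t K y * L y x) \<in> poly_space k r"
    by (rule poly_space_sum[OF XL(2)])
  ultimately show "time_deriv w t K \<in> poly_space k r" by simp
qed

text \<open>The common form of the energy terms and the ghost penalty: \<open>A\<close> is a linear operator on the broken
  space that sees \<open>z\<close> only through its values at the nodes \<open>X\<close> in the cells \<open>\<K>\<close>. It is
  instantiated with the gradient and the evaluation in one cell and with the jump of a normal derivative
  between two cells.\<close>

lemma has_real_derivative_quadratic_trajectory: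
  fixes A :: "'a::euclidean_space broken \<Rightarrow> 'a \<Rightarrow> 'b::euclidean_space"
  assumes U: "open U" "t \<in> U" and space: "\<And>s. s \<in> U \<Longrightarrow> w s \<in> broken_space M k r"
    and diff: "\<And>K x. K \<in> active_mesh M \<Longrightarrow> (\<lambda>s. w s K x) differentiable (at t)"
    and \<K>: "\<K> \<subseteq> active_mesh M"
    and A: "\<And>z x. z \<in> broken_space M k r \<Longrightarrow> A z x = (\<Sum>(K, y)\<in>\<K> \<times> X. z K y *\<^sub>R G K y x)"
    and int: "\<And>K y K' y'. K \<in> \<K> \<Longrightarrow> y \<in> X \<Longrightarrow> K' \<in> \<K> \<Longrightarrow> y' \<in> X \<Longrightarrow>
      set_integrable \<mu> S (\<lambda>x. G K y x \<bullet> G K' y' x)"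
  shows "((\<lambda>s. LINT x:S|\<mu>. A (w s) x \<bullet> A (w s) x) has_real_derivative
    2 * (LINT x:S|\<mu>. A (time_deriv w t) x \<bullet> A (w t) x)) (at t)"
proof (rule has_real_derivative_set_integral_square
    [where I = "\<K> \<times> X" and G = "\<lambda>(K, y). G K y" and c = "\<lambda>(K, y) s. w s K y"
      and c' = "\<lambda>(K, y). time_deriv w t K y", OF _ _ U])
  show "set_integrable \<mu> S (\<lambda>x. (case i of (K, y) \<Rightarrow> G K y) x \<bullet> (case j of (K, y) \<Rightarrow> G K y) x)"
    if "i \<in> \<K> \<times> X" "j \<in> \<K> \<times> X" for i j
    using that int by auto
  show "((case i of (K, y) \<Rightarrow> \<lambda>s. w s K y) has_real_derivative
      (case i of (K, y) \<Rightarrow> time_deriv w t K y)) (at t)" if "i \<in> \<K> \<times> X" for i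
    using that diff \<K> by (auto simp: time_deriv_def DERIV_deriv_iff_real_differentiable)
  show "A (w s) x = (\<Sum>i\<in>\<K> \<times> X. (case i of (K, y) \<Rightarrow> \<lambda>s. w s K y) s *\<^sub>R
      (case i of (K, y) \<Rightarrow> G K y) x)" if "s \<in> U" for s x
    using A[OF space[OF that]] by (simp add: case_prod_beta)
  show "A (time_deriv w t) x = (\<Sum>i\<in>\<K> \<times> X. (case i of (K, y) \<Rightarrow> time_deriv w t K y) *\<^sub>R
      (case i of (K, y) \<Rightarrow> G K y) x)" for x
    using A[OF time_deriv_broken_space[OF U space diff]] by (simp add: case_prod_beta)
qed

lemma has_real_derivative_cell_integrals:
  fixes w :: "real \<Rightarrow> 'a::euclidean_space broken"
  assumes U: "open U" "t \<in> U" and space: "\<And>s. s \<in> U \<Longrightarrow> w s \<in> broken_space M k r"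
    and diff: "\<And>K x. K \<in> active_mesh M \<Longrightarrow> (\<lambda>s. w s K x) differentiable (at t)"
    and K: "K \<in> active_mesh M" and S: "S \<in> sets borel" "bounded S"
  shows "((\<lambda>s. LINT x:S|lborel. (norm (grad (w s K) x))\<^sup>2) has_real_derivative
      2 * (LINT x:S|lborel. grad (time_deriv w t K) x \<bullet> grad (w t K) x)) (at t)"
    and "((\<lambda>s. LINT x:S|lborel. (w s K x)\<^sup>2) has_real_derivative
      2 * (LINT x:S|lborel. time_deriv w t K x * w t K x)) (at t)"
proof -
  obtain X :: "'a set" and L where XL: "finite X" "\<And>y. y \<in> X \<Longrightarrow> L y \<in> poly_space k r"
    "\<And>f. f \<in> poly_space k r \<Longrightarrow> f = (\<lambda>z. \<Sum>y\<in>X. f y * L y z)"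
    by (rule poly_space_interpolation[of k r]) (rule that)
  have repr: "z K = (\<lambda>x. \<Sum>y\<in>X. z K y * L y x)" if "z \<in> broken_space M k r" for z
    using that K by (intro XL(3)) (simp add: broken_space_def)
  have prod: "(\<Sum>(K', y)\<in>{K} \<times> X. f K' y) = (\<Sum>y\<in>X. f K y)" for f :: "'a set \<Rightarrow> 'a \<Rightarrow> 'c::comm_monoid_add"
    by (subst sum.cartesian_product[symmetric]) simp
  show "((\<lambda>s. LINT x:S|lborel. (norm (grad (w s K) x))\<^sup>2) has_real_derivative
      2 * (LINT x:S|lborel. grad (time_deriv w t K) x \<bullet> grad (w t K) x)) (at t)"
    unfolding power2_norm_eq_inner
  proof (rule has_real_derivative_quadratic_trajectory
      [where \<K> = "{K}" and X = X and G = "\<lambda>_ y. grad (L y)" and A = "\<lambda>z. grad (z K)", OF U space diff])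
    show "grad (z K) x = (\<Sum>(K, y)\<in>{K} \<times> X. z K y *\<^sub>R grad (L y) x)" if "z \<in> broken_space M k r" for z x
      unfolding prod by (subst repr[OF that]) (rule grad_linear_combination[OF XL(2)])
    show "set_integrable lborel S (\<lambda>x. grad (L y) x \<bullet> grad (L y') x)" if "y \<in> X" "y' \<in> X" for y y'
      by (intro set_integrable_continuous_bounded S continuous_on_inner
          GDERIV_grad_poly(2)[OF XL(2)] that)
  qed (use K in auto)
  have "((\<lambda>s. LINT x:S|lborel. w s K x \<bullet> w s K x) has_real_derivative
      2 * (LINT x:S|lborel. time_deriv w t K x \<bullet> w t K x)) (at t)"
  proof (rule has_real_derivative_quadratic_trajectory
      [where \<K> = "{K}" and X = X and G = "\<lambda>_ y. L y" and A = "\<lambda>z. z K", OF U space diff])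
    show "z K x = (\<Sum>(K, y)\<in>{K} \<times> X. z K y *\<^sub>R L y x)" if "z \<in> broken_space M k r" for z x
      unfolding prod by (subst repr[OF that]) simp
    show "set_integrable lborel S (\<lambda>x. L y x \<bullet> L y' x)" if "y \<in> X" "y' \<in> X" for y y'
      by (intro set_integrable_continuous_bounded S continuous_on_inner
          continuous_on_poly_space[OF XL(2)] that)
  qed (use K in auto)
  then show "((\<lambda>s. LINT x:S|lborel. (w s K x)\<^sup>2) has_real_derivative
      2 * (LINT x:S|lborel. time_deriv w t K x * w t K x)) (at t)"
    by (simp add: power2_eq_square)
qed


section \<open>Bounds for the surface measure\<close>

lemma space_surface_measure [simp]: "space surface_measure = UNIV"
  and sets_surface_measure [simp, measurable_cong]: "sets surface_measure = sets borel"
  by (simp_all add: surface_measure_def space_measure_of_conv sets_measure_of_conv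
      sets.sigma_sets_eq[of borel, simplified])

lemma emeasure_surface_measure:
  "emeasure (surface_measure :: 'a::euclidean_space measure) A =
    (if A \<in> sets borel \<and> measure_space UNIV (sets borel) (hausdorff_outer (DIM('a) - 1) :: 'a set \<Rightarrow> ennreal)
     then hausdorff_outer (DIM('a) - 1) A else 0)"
  by (simp add: surface_measure_def emeasure_measure_of_conv sets.sigma_sets_eq[of borel, simplified])

text \<open>The index is the least one whose subinterval does not end before \<open>x\<close>. The form of the
  statement also covers the degenerate segment \<open>a = b\<close>.\<close>

lemma segment_subdivision:
  fixes a b x :: real and n :: nat
  assumes "a \<le> x" "x \<le> b" "0 < n"
  shows "\<exists>k<n. a + real k * ((b - a) / n) \<le> x \<and> x \<le> a + (real k + 1) * ((b - a) / n)"
proof -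
  define k where "k = (LEAST k. x \<le> a + (real k + 1) * ((b - a) / n))"
  have *: "x \<le> a + (real (n - 1) + 1) * ((b - a) / n)"
    using assms by (simp add: of_nat_diff)
  then have "k \<le> n - 1" unfolding k_def by (rule Least_le)
  moreover have "x \<le> a + (real k + 1) * ((b - a) / n)"
    unfolding k_def using * by (rule LeastI)
  moreover have "a + real k * ((b - a) / n) \<le> x"
  proof (cases k)
    case 0
    then show ?thesis using assms by simp
  next
    case (Suc k')
    then have "\<not> x \<le> a + (real k' + 1) * ((b - a) / n)"
      unfolding k_def by (intro not_less_Least) simp
    with Suc show ?thesis by (simp add: add.commute)
  qed
  ultimately show ?thesis using \<open>0 < n\<close> by (intro exI[of _ k]) auto
qed

text \<open>Cutting the face into \<open>n ^ (d - 1)\<close> congruent pieces divides the diameter by \<open>n\<close>, so that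
  the total weight of these coverings has a bound independent of \<open>n\<close>.\<close>

lemma hausdorff_outer_face_finite:
  fixes a b :: "'a::euclidean_space"
  assumes i: "i \<in> Basis"
  shows "hausdorff_outer (DIM('a) - 1) {x \<in> cbox a b. x \<bullet> i = c} < \<infinity>"
proof -
  let ?m = "DIM('a) - 1" and ?A = "{x \<in> cbox a b. x \<bullet> i = c}"
  define D where "D = norm (b - a)"
  let ?bound = "ennreal (unit_ball_vol (real ?m) * (D / 2) ^ ?m)"
  have "hausdorff_pre ?m \<delta> ?A \<le> ?bound" if "0 < \<delta>" for \<delta>
  proof -
    obtain n :: nat where n: "0 < n" "D / n \<le> \<delta>"
    proof -
      obtain n :: nat where "D / \<delta> < n" using reals_Archimedean2 by blast
      with \<open>0 < \<delta>\<close> have "D < real n * \<delta>" by (simp add: pos_divide_less_eq)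
      with \<open>0 < \<delta>\<close> have "D \<le> \<delta> * real (Suc n)" by (simp add: algebra_simps)
      then have "D / Suc n \<le> \<delta>" by (simp only: pos_divide_le_eq of_nat_0_less_iff zero_less_Suc)
      then show ?thesis by (intro that[of "Suc n"]) auto
    qed
    define w where "w j = (b \<bullet> j - a \<bullet> j) / n" for j
    define P :: "('a \<Rightarrow> nat) set" where "P = (Basis - {i}) \<rightarrow>\<^sub>E {..<n}"
    define Q where "Q f = {x. x \<bullet> i = c \<and>
        (\<forall>j\<in>Basis - {i}. a \<bullet> j + real (f j) * w j \<le> x \<bullet> j \<and> x \<bullet> j \<le> a \<bullet> j + (real (f j) + 1) * w j)}"
      for f :: "'a \<Rightarrow> nat"
    have P: "finite P" "card P = n ^ ?m"
      using i by (auto simp: P_def card_PiE intro!: finite_PiE)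
    have dist_Q: "norm (x - y) \<le> D / n" if "x \<in> Q f" "y \<in> Q f" for f x y
    proof -
      have "norm (x - y) \<le> norm ((1 / n) *\<^sub>R (b - a))"
      proof (rule norm_le_componentwise)
        fix j :: 'a assume j: "j \<in> Basis"
        have "\<bar>(x - y) \<bullet> j\<bar> \<le> \<bar>w j\<bar>"
        proof (cases "j = i")
          case False
          with that j have "a \<bullet> j + real (f j) * w j \<le> x \<bullet> j" "x \<bullet> j \<le> a \<bullet> j + (real (f j) + 1) * w j"
            "a \<bullet> j + real (f j) * w j \<le> y \<bullet> j" "y \<bullet> j \<le> a \<bullet> j + (real (f j) + 1) * w j"
            by (auto simp: Q_def)
          then show ?thesis by (simp add: inner_diff_left distrib_right)
        qed (use that in \<open>simp add: Q_def inner_diff_left\<close>)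
        then show "\<bar>(x - y) \<bullet> j\<bar> \<le> \<bar>((1 / n) *\<^sub>R (b - a)) \<bullet> j\<bar>"
          by (simp add: w_def inner_diff_left)
      qed
      also have "\<dots> = D / n" by (simp add: D_def)
      finally show ?thesis .
    qed
    have D0: "0 \<le> D / n" by (simp add: D_def)
    have diam_Q: "diameter (Q f) \<le> D / n" for f
      using dist_Q D0 by (intro diameter_le) auto
    have bounded_Q: "bounded (Q f)" for f
    proof (cases "Q f = {}")
      case False
      then obtain y where "y \<in> Q f" by blast
      with dist_Q[of _ f y] show ?thesis
        by (intro bounded_subset[OF bounded_cball[of y "D / n"]]) (auto simp: dist_norm norm_minus_commute)
    qed simp
    have weight_Q: "hausdorff_weight ?m (Q f) \<le> ennreal (unit_ball_vol (real ?m) * (D / n / 2) ^ ?m)" for f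
      unfolding hausdorff_weight_def using diam_Q[of f] diameter_ge_0[OF bounded_Q, of f]
      by (auto intro!: ennreal_leI mult_left_mono power_mono)
    have cover: "\<exists>f\<in>P. x \<in> Q f" if "x \<in> ?A" for x
    proof -
      have "\<exists>k<n. a \<bullet> j + real k * w j \<le> x \<bullet> j \<and> x \<bullet> j \<le> a \<bullet> j + (real k + 1) * w j" if "j \<in> Basis" for j
        unfolding w_def using \<open>x \<in> ?A\<close> that n(1) by (intro segment_subdivision) (auto simp: mem_box)
      then obtain f where f: "\<And>j. j \<in> Basis \<Longrightarrow> f j < n \<and> a \<bullet> j + real (f j) * w j \<le> x \<bullet> j
          \<and> x \<bullet> j \<le> a \<bullet> j + (real (f j) + 1) * w j"
        by metis
      then have "restrict f (Basis - {i}) \<in> P" "x \<in> Q (restrict f (Basis - {i}))"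
        using that by (auto simp: P_def Q_def)
      then show ?thesis by blast
    qed
    obtain h where h: "bij_betw h {0..<card P} P"
      using ex_bij_betw_nat_finite[OF P(1)] by blast
    define C where "C l = (if l < card P then Q (h l) else {})" for l
    have "?A \<subseteq> (\<Union>l. C l)"
    proof
      fix x assume "x \<in> ?A"
      then obtain f where "f \<in> P" "x \<in> Q f" using cover by blast
      moreover from \<open>f \<in> P\<close> h obtain l where "l < card P" "f = h l"
        by (metis bij_betw_imp_surj_on imageE atLeastLessThan_iff)
      ultimately have "x \<in> C l" by (simp add: C_def)
      then show "x \<in> (\<Union>l. C l)" by blast
    qed
    moreover have "bounded (C l) \<and> diameter (C l) \<le> \<delta>" for l
      using bounded_Q diam_Q[of "h l"] n(2) that by (auto simp: C_def)
    ultimately have "hausdorff_pre ?m \<delta> ?A \<le> (\<Sum>l. hausdorff_weight ?m (C l))"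
      unfolding hausdorff_pre_def by (intro INF_lower) blast
    also have "\<dots> = (\<Sum>l<card P. hausdorff_weight ?m (C l))"
      by (rule suminf_finite) (auto simp: C_def hausdorff_weight_def)
    also have "\<dots> \<le> (\<Sum>l<card P. ennreal (unit_ball_vol (real ?m) * (D / n / 2) ^ ?m))"
      using weight_Q by (intro sum_mono) (simp only: C_def lessThan_iff if_True)
    also have "\<dots> = ennreal (real (n ^ ?m) * (unit_ball_vol (real ?m) * (D / n / 2) ^ ?m))"
      using D0 by (simp add: P(2) ennreal_mult ennreal_of_nat_eq_real_of_nat)
    also have "real (n ^ ?m) * (unit_ball_vol (real ?m) * (D / n / 2) ^ ?m) =
        unit_ball_vol (real ?m) * (real n * (D / n / 2)) ^ ?m"
      by (simp add: power_mult_distrib del: times_divide_eq_right times_divide_eq_left)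
    also have "real n * (D / n / 2) = D / 2" using n(1) by simp
    finally show ?thesis .
  qed
  then have "hausdorff_outer ?m ?A \<le> ?bound"
    unfolding hausdorff_outer_def by (intro SUP_least) simp
  then show ?thesis
    by (rule order.strict_trans1) simp
qed

text \<open>Every covering of a flat piece extends to a covering of a cylinder over it: replace a covering set
  \<open>C\<close> by a box with half-width \<open>diameter C\<close> in the hyperplane directions and with fixed height in the
  direction \<open>i\<close>. The volume of this box is a constant multiple of the weight of \<open>C\<close>, hence the total
  weight is at least a constant times the volume of the cylinder.\<close>

lemma hausdorff_outer_hyperplane_pos:
  fixes x :: "'a::euclidean_space"
  assumes i: "i \<in> Basis" and "0 < \<delta>" and A: "{y \<in> ball x \<delta>. (y - x) \<bullet> i = 0} \<subseteq> A"
  shows "0 < hausdorff_outer (DIM('a) - 1) A"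
proof -
  let ?m = "DIM('a) - 1"
  define r where "r = \<delta> / (2 * DIM('a))"
  have r: "0 < r" using \<open>0 < \<delta>\<close> by (simp add: r_def)
  define Z where "Z = cbox (x - r *\<^sub>R One) (x + r *\<^sub>R One)"
  have Z: "emeasure lborel Z = ennreal ((2 * r) ^ DIM('a))"
    using r by (simp add: Z_def algebra_simps)
  define V where "V = unit_ball_vol (real ?m)"
  have V: "0 < V" by (simp add: V_def)
  define c where "c = 2 * r * 4 ^ ?m / V"
  have c: "0 < c" using r V by (simp add: c_def)
  have lower: "ennreal ((2 * r) ^ DIM('a) / c) \<le> (\<Sum>l. hausdorff_weight ?m (C l))"
    if cover: "A \<subseteq> (\<Union>l. C l)" and bounded: "\<And>l. bounded (C l)" for C :: "nat \<Rightarrow> 'a set"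
  proof -
    define p where "p l = (SOME p. p \<in> C l)" for l
    define lo where "lo l = (\<Sum>j\<in>Basis. (if j = i then x \<bullet> i - r else p l \<bullet> j - diameter (C l)) *\<^sub>R j)" for l
    define hi where "hi l = (\<Sum>j\<in>Basis. (if j = i then x \<bullet> i + r else p l \<bullet> j + diameter (C l)) *\<^sub>R j)" for l
    define Y where "Y l = (if C l = {} then {} else cbox (lo l) (hi l))" for l
    have "Z \<subseteq> (\<Union>l. Y l)"
    proof
      fix z assume "z \<in> Z"
      then have z: "\<And>j. j \<in> Basis \<Longrightarrow> \<bar>(z - x) \<bullet> j\<bar> \<le> r"
        by (auto simp: Z_def mem_box inner_diff_left inner_add_left abs_le_iff algebra_simps)
      \<comment> \<open>the projection of \<open>z\<close> to the hyperplane\<close>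
      define y where "y = z - ((z - x) \<bullet> i) *\<^sub>R i"
      have y: "y \<bullet> j = (if j = i then x \<bullet> i else z \<bullet> j)" if "j \<in> Basis" for j
        using that i by (simp add: y_def inner_diff_left inner_Basis)
      have "norm (y - x) \<le> (\<Sum>j\<in>Basis. \<bar>(y - x) \<bullet> j\<bar>)" by (rule norm_le_l1)
      also have "\<dots> \<le> (\<Sum>j\<in>(Basis :: 'a set). r)"
      proof (rule sum_mono)
        fix j :: 'a assume "j \<in> Basis"
        then show "\<bar>(y - x) \<bullet> j\<bar> \<le> r"
          using z[of j] y[of j] r by (simp add: inner_diff_left)
      qed
      also have "\<dots> < \<delta>" using \<open>0 < \<delta>\<close> by (simp add: r_def)
      finally have "y \<in> A"
        using A y[OF i] by (auto simp: dist_norm norm_minus_commute inner_diff_left)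
      then obtain l where l: "y \<in> C l" using cover by blast
      then have "p l \<in> C l" unfolding p_def by (rule someI)
      then have "\<bar>(y - p l) \<bullet> j\<bar> \<le> diameter (C l)" if "j \<in> Basis" for j
        using Basis_le_norm[OF that, of "y - p l"] diameter_bounded_bound[OF bounded l, of "p l"]
        by (simp add: dist_norm)
      then have "z \<in> Y l"
        using l z[OF i] y by (auto simp: Y_def lo_def hi_def mem_box abs_le_iff inner_diff_left algebra_simps)
          (smt (verit))+
      then show "z \<in> (\<Union>l. Y l)" by blast
    qed
    then have "emeasure lborel Z \<le> emeasure lborel (\<Union>l. Y l)"
      by (intro emeasure_mono) (auto simp: Y_def)
    also have "\<dots> \<le> (\<Sum>l. emeasure lborel (Y l))"
      by (intro emeasure_subadditive_countably) (auto simp: Y_def)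
    also have "\<dots> = (\<Sum>l. ennreal c * hausdorff_weight ?m (C l))"
    proof (rule suminf_cong)
      fix l
      have d: "0 \<le> diameter (C l)" by (rule diameter_ge_0[OF bounded])
      have "emeasure lborel (cbox (lo l) (hi l)) = ennreal (\<Prod>j\<in>Basis. if j = i then 2 * r else 2 * diameter (C l))"
        using d r by (subst emeasure_lborel_cbox)
          (auto simp: lo_def hi_def inner_diff_left intro!: prod.cong arg_cong[of _ _ ennreal])
      also have "(\<Prod>j\<in>Basis. if j = i then 2 * r else 2 * diameter (C l)) =
          2 * r * (\<Prod>j\<in>Basis - {i}. 2 * diameter (C l))"
        using i by (subst prod.remove[of _ i]) (auto intro!: prod.cong)
      also have "\<dots> = 2 * r * (2 * diameter (C l)) ^ ?m"
        using i by simp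
      also have "(2 * diameter (C l)) ^ ?m = 4 ^ ?m * (diameter (C l) / 2) ^ ?m"
        by (subst power_mult_distrib[symmetric]) simp
      also have "2 * r * (4 ^ ?m * (diameter (C l) / 2) ^ ?m) = c * (V * (diameter (C l) / 2) ^ ?m)"
        using V by (simp add: c_def)
      finally have "emeasure lborel (cbox (lo l) (hi l)) = ennreal c * ennreal (V * (diameter (C l) / 2) ^ ?m)"
        using c V d by (simp only: ennreal_mult less_imp_le mult_nonneg_nonneg zero_le_power
            divide_nonneg_pos zero_less_numeral)
      then show "emeasure lborel (Y l) = ennreal c * hausdorff_weight ?m (C l)"
        by (simp only: Y_def hausdorff_weight_def V_def) simp
    qed
    also have "\<dots> = ennreal c * (\<Sum>l. hausdorff_weight ?m (C l))" by simp
    finally have le: "ennreal ((2 * r) ^ DIM('a)) \<le> ennreal c * (\<Sum>l. hausdorff_weight ?m (C l))"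
      unfolding Z .
    have "ennreal ((2 * r) ^ DIM('a) / c) = ennreal (1 / c) * ennreal ((2 * r) ^ DIM('a))"
      using c r by (simp flip: ennreal_mult)
    also have "\<dots> \<le> ennreal (1 / c) * (ennreal c * (\<Sum>l. hausdorff_weight ?m (C l)))"
      by (intro mult_left_mono le) simp
    also have "\<dots> = ennreal (1 / c * c) * (\<Sum>l. hausdorff_weight ?m (C l))"
      using c by (simp add: mult.assoc[symmetric] ennreal_mult[symmetric])
    also have "\<dots> = (\<Sum>l. hausdorff_weight ?m (C l))"
      using c by simp
    finally show ?thesis .
  qed
  have "0 < ennreal ((2 * r) ^ DIM('a) / c)"
    using r c by simp
  also have "\<dots> \<le> hausdorff_pre ?m 1 A"
    unfolding hausdorff_pre_def using lower by (intro INF_greatest) auto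
  also have "\<dots> \<le> hausdorff_outer ?m A"
    unfolding hausdorff_outer_def by (intro SUP_upper) simp
  finally show ?thesis .
qed

text \<open>A set function from which \<open>measure_of\<close> cannot make a measure is replaced by zero. The first case
  makes every boundary integral vanish.\<close>

lemma surface_measure_cases:
  obtains (null) "\<And>A :: 'a::euclidean_space set. emeasure surface_measure A = 0"
  | (hausdorff) "\<forall>A\<in>sets (borel :: 'a::euclidean_space measure).
      emeasure surface_measure A = hausdorff_outer (DIM('a) - 1) A"
  by (cases "measure_space UNIV (sets borel) (hausdorff_outer (DIM('a) - 1) :: 'a set \<Rightarrow> ennreal)")
    (auto simp: emeasure_surface_measure)

lemma emeasure_surface_frontier_cbox:
  fixes a b :: "'a::euclidean_space"
  shows "emeasure surface_measure (frontier (cbox a b)) < \<infinity>"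
proof -
  let ?I = "Basis \<times> {a, b}"
  let ?A = "\<lambda>(i, e). {x \<in> cbox a b. x \<bullet> i = e \<bullet> i}"
  have closed: "closed (?A ie)" for ie :: "'a \<times> 'a"
    using closed_Int[OF closed_cbox[of a b] closed_hyperplane[of "fst ie" "snd ie \<bullet> fst ie"]]
    by (simp add: case_prod_beta Int_def inner_commute)
  have face: "emeasure surface_measure (?A ie) < \<infinity>" if "ie \<in> ?I" for ie
  proof -
    have "emeasure surface_measure (?A ie) \<le> hausdorff_outer (DIM('a) - 1) (?A ie)"
      by (simp add: emeasure_surface_measure)
    also have "\<dots> < \<infinity>"
      using that hausdorff_outer_face_finite[of "fst ie" a b "snd ie \<bullet> fst ie"]
      by (auto simp: case_prod_beta)
    finally show ?thesis .
  qed
  have "frontier (cbox a b) \<subseteq> (\<Union>ie\<in>?I. ?A ie)"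
  proof
    fix x assume "x \<in> frontier (cbox a b)"
    then have "x \<in> cbox a b" "x \<notin> box a b" by (auto simp: frontier_cbox)
    then obtain i where "i \<in> Basis" "x \<bullet> i = a \<bullet> i \<or> x \<bullet> i = b \<bullet> i"
      by (force simp: mem_box)
    with \<open>x \<in> cbox a b\<close> show "x \<in> (\<Union>ie\<in>?I. ?A ie)" by auto
  qed
  then have "emeasure surface_measure (frontier (cbox a b)) \<le> emeasure surface_measure (\<Union>ie\<in>?I. ?A ie)"
    using closed by (intro emeasure_mono) (auto intro!: borel_closed closed_UN simp: closed_UN)
  also have "\<dots> \<le> (\<Sum>ie\<in>?I. emeasure surface_measure (?A ie))"
    using closed by (intro emeasure_subadditive_finite) (auto intro!: borel_closed simp del: case_prod_conv)
  also have "\<dots> < \<infinity>"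
    using face by (simp add: ennreal_sum_less_top)
  finally show ?thesis .
qed


section \<open>Outward normals\<close>

text \<open>If \<open>n\<close> is a normal, then moving from \<open>x\<close> in the direction \<open>m - n\<close> enters \<open>A\<close>, because
  \<open>(m - n) \<bullet> n < 0\<close>, and at the same time goes to the outer side with respect to \<open>m\<close>, because
  \<open>(m - n) \<bullet> m > 0\<close>. Hence \<open>m\<close> can neither be another normal nor support \<open>A\<close> from outside.\<close>

lemma outward_normal_cone:
  assumes n: "is_outward_normal A x n" and m: "norm m = 1" "m \<noteq> n"
  obtains \<epsilon> where "0 < \<epsilon>"
    and "\<And>\<delta>. 0 < \<delta> \<Longrightarrow> \<exists>y. dist y x < \<delta> \<and> y \<in> A \<and> (y - x) \<bullet> m > \<epsilon> * norm (y - x)"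
proof -
  have norm_n: "norm n = 1" using n by (simp add: is_outward_normal_def)
  define e where "e = 1 - m \<bullet> n"
  define q where "q = norm (m - n)"
  have q: "0 < q" using m by (simp add: q_def)
  have "q\<^sup>2 = 2 * e"
    unfolding q_def power2_norm_eq_inner e_def using m norm_n
    by (simp add: inner_diff_left inner_diff_right norm_eq_1 inner_commute)
  then have e: "0 < e" using q by (metis zero_less_power zero_less_mult_pos zero_less_numeral)
  define \<epsilon> where "\<epsilon> = e / (2 * q)"
  have \<epsilon>: "0 < \<epsilon>" using e q by (simp add: \<epsilon>_def)
  have "\<exists>y. dist y x < \<delta> \<and> y \<in> A \<and> (y - x) \<bullet> m > \<epsilon> * norm (y - x)" if \<delta>: "0 < \<delta>" for \<delta>
  proof -
    from n \<epsilon> obtain \<delta>' where \<delta>': "0 < \<delta>'" and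
      A: "\<And>y. dist y x < \<delta>' \<Longrightarrow> (y - x) \<bullet> n < - \<epsilon> * norm (y - x) \<Longrightarrow> y \<in> A"
      unfolding is_outward_normal_def by blast
    define s where "s = min \<delta> \<delta>' / (2 * q)"
    define y where "y = x + s *\<^sub>R (m - n)"
    have s: "0 < s" using \<delta> \<delta>' q by (simp add: s_def)
    have norm_y: "norm (y - x) = s * q" using s by (simp add: y_def q_def)
    have "s * q < min \<delta> \<delta>'" using \<delta> \<delta>' q by (auto simp: s_def min_def)
    then have dist: "dist y x < \<delta>" "dist y x < \<delta>'" by (simp_all add: dist_norm norm_y)
    have "(m - n) \<bullet> n = - e" "(m - n) \<bullet> m = e"
      unfolding inner_diff_left e_def using m norm_n by (simp_all add: norm_eq_1 inner_commute)
    then have "(y - x) \<bullet> n = - (s * e)" "(y - x) \<bullet> m = s * e"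
      by (simp_all add: y_def)
    moreover have "\<epsilon> * norm (y - x) = s * e / 2" using q by (simp add: \<epsilon>_def norm_y)
    moreover have "0 < s * e" using s e by simp
    ultimately have "(y - x) \<bullet> n < - \<epsilon> * norm (y - x)" "(y - x) \<bullet> m > \<epsilon> * norm (y - x)"
      by simp_all
    with A dist show ?thesis by blast
  qed
  with \<epsilon> show ?thesis by (rule that)
qed

lemma outward_normal_unique:
  assumes n: "is_outward_normal A x n" and m: "is_outward_normal A x m"
  shows "m = n"
proof (rule ccontr)
  assume "m \<noteq> n"
  moreover have "norm m = 1" using m by (simp add: is_outward_normal_def)
  ultimately obtain \<epsilon> where \<epsilon>: "0 < \<epsilon>" and
    cone: "\<And>\<delta>. 0 < \<delta> \<Longrightarrow> \<exists>y. dist y x < \<delta> \<and> y \<in> A \<and> (y - x) \<bullet> m > \<epsilon> * norm (y - x)"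
    using outward_normal_cone[OF n] by metis
  from m \<epsilon> obtain \<delta> where "0 < \<delta>"
    "\<And>y. dist y x < \<delta> \<Longrightarrow> (y - x) \<bullet> m > \<epsilon> * norm (y - x) \<Longrightarrow> y \<notin> A"
    unfolding is_outward_normal_def by blast
  with cone show False by blast
qed

lemma outward_normal_eqI: "is_outward_normal A x n \<Longrightarrow> outward_normal A x = n"
  unfolding outward_normal_def by (auto intro!: the_equality dest: outward_normal_unique)

lemma is_outward_normal_outward_normal:
  assumes "outward_normal A x \<noteq> 0"
  shows "is_outward_normal A x (outward_normal A x)"
proof -
  obtain n where "is_outward_normal A x n"
    using assms by (auto simp: outward_normal_def split: if_splits)
  with outward_normal_eqI[OF this] show ?thesis by simp
qed

lemma norm_outward_normal_le: "norm (outward_normal A x) \<le> 1"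
proof (cases "outward_normal A x = 0")
  case False
  then show ?thesis using is_outward_normal_outward_normal[of A x] by (simp add: is_outward_normal_def)
qed simp

lemma outward_normal_supporting:
  assumes n: "is_outward_normal A x n" and m: "norm m = 1" and A: "\<And>y. y \<in> A \<Longrightarrow> (y - x) \<bullet> m \<le> 0"
  shows "n = m"
proof (rule ccontr)
  assume "n \<noteq> m"
  then obtain \<epsilon> where \<epsilon>: "0 < \<epsilon>" and
    cone: "\<And>\<delta>. 0 < \<delta> \<Longrightarrow> \<exists>y. dist y x < \<delta> \<and> y \<in> A \<and> (y - x) \<bullet> m > \<epsilon> * norm (y - x)"
    using outward_normal_cone[OF n m] by metis
  from cone[of 1] obtain y where "y \<in> A" "(y - x) \<bullet> m > \<epsilon> * norm (y - x)" by auto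
  moreover have "0 \<le> \<epsilon> * norm (y - x)" using \<epsilon> by simp
  ultimately show False using A[of y] by linarith
qed

lemma is_outward_normal_local:
  assumes d: "0 < d" and eq: "\<And>y. dist y x < d \<Longrightarrow> y \<in> A \<longleftrightarrow> y \<in> B" and n: "is_outward_normal A x n"
  shows "is_outward_normal B x n"
  unfolding is_outward_normal_def
proof (intro conjI allI impI)
  show "norm n = 1" using n by (simp add: is_outward_normal_def)
  fix \<epsilon> :: real assume "0 < \<epsilon>"
  with n obtain \<delta> where "0 < \<delta>" and \<delta>: "\<And>y. dist y x < \<delta> \<Longrightarrow>
      ((y - x) \<bullet> n < - \<epsilon> * norm (y - x) \<longrightarrow> y \<in> A) \<and> ((y - x) \<bullet> n > \<epsilon> * norm (y - x) \<longrightarrow> y \<notin> A)"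
    unfolding is_outward_normal_def by blast
  have "((y - x) \<bullet> n < - \<epsilon> * norm (y - x) \<longrightarrow> y \<in> B) \<and> ((y - x) \<bullet> n > \<epsilon> * norm (y - x) \<longrightarrow> y \<notin> B)"
    if "dist y x < min d \<delta>" for y
    using \<delta>[of y] eq[of y] that by simp
  then show "\<exists>\<delta>>0. \<forall>y. dist y x < \<delta> \<longrightarrow>
      ((y - x) \<bullet> n < - \<epsilon> * norm (y - x) \<longrightarrow> y \<in> B) \<and> ((y - x) \<bullet> n > \<epsilon> * norm (y - x) \<longrightarrow> y \<notin> B)"
    using d \<open>0 < \<delta>\<close> by (intro exI[of _ "min d \<delta>"]) simp
qed

lemma outward_normal_local:
  assumes "0 < d" "\<And>y. dist y x < d \<Longrightarrow> y \<in> A \<longleftrightarrow> y \<in> B"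
  shows "outward_normal A x = outward_normal B x"
proof -
  have "is_outward_normal A x n \<longleftrightarrow> is_outward_normal B x n" for n
    using is_outward_normal_local[of d x A B n] is_outward_normal_local[of d x B A n] assms by blast
  then have "is_outward_normal A x = is_outward_normal B x" by (rule ext)
  then show ?thesis by (simp add: outward_normal_def)
qed

lemma outward_normal_Int_open:
  assumes "open U" "x \<in> U"
  shows "outward_normal (A \<inter> U) x = outward_normal A x"
proof -
  obtain d where "0 < d" "\<And>y. dist y x < d \<Longrightarrow> y \<in> U"
    using assms by (auto simp: open_dist)
  then show ?thesis by (intro outward_normal_local[of d]) auto
qed

lemma is_outward_normal_half_space:
  assumes "0 < d" "\<And>y. dist y x < d \<Longrightarrow> y \<in> A \<longleftrightarrow> (y - x) \<bullet> m \<le> 0" "norm m = 1"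
  shows "is_outward_normal A x m"
proof (rule is_outward_normal_local[OF \<open>0 < d\<close>, where A = "{y. (y - x) \<bullet> m \<le> 0}"])
  show "is_outward_normal {y. (y - x) \<bullet> m \<le> 0} x m"
    unfolding is_outward_normal_def
  proof (intro conjI allI impI exI[of _ 1])
    fix \<epsilon> :: real and y assume "0 < \<epsilon>"
    then have nonneg: "0 \<le> \<epsilon> * norm (y - x)" by simp
    show "y \<in> {y. (y - x) \<bullet> m \<le> 0}" if "(y - x) \<bullet> m < - \<epsilon> * norm (y - x)"
      using that nonneg by simp
    show "y \<notin> {y. (y - x) \<bullet> m \<le> 0}" if "(y - x) \<bullet> m > \<epsilon> * norm (y - x)"
      using that nonneg by simp
  qed (use \<open>norm m = 1\<close> in auto)
qed (use assms in auto)

text \<open>For fixed \<open>\<epsilon>\<close> and \<open>\<delta>\<close> the pairs \<open>(n, x)\<close> that satisfy the condition of the definition of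
  a normal form a closed set \<open>C\<close>, since each of the excluded pairs is excluded by a single \<open>y\<close> through
  strict inequalities. The projection of a closed set along the compact sphere is closed. A compactness
  argument allows the normal \<open>n\<close> to depend on \<open>\<epsilon>\<close>, so that the points with a normal in a given
  closed set form a countable intersection of countable unions of closed sets.\<close>

lemma borel_measurable_outward_normal: "outward_normal A \<in> borel_measurable borel"
proof -
  define C where "C \<epsilon> \<delta> = {(n, x). \<forall>y. dist y x < \<delta> \<longrightarrow>
        ((y - x) \<bullet> n < - \<epsilon> * norm (y - x) \<longrightarrow> y \<in> A) \<and>
        ((y - x) \<bullet> n > \<epsilon> * norm (y - x) \<longrightarrow> y \<notin> A)}" for \<epsilon> \<delta> :: real
  have closed_C: "closed (C \<epsilon> \<delta>)" for \<epsilon> \<delta>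
  proof -
    have "- C \<epsilon> \<delta> = (\<Union>y\<in>-A. {z. dist y (snd z) < \<delta> \<and> (y - snd z) \<bullet> fst z < - \<epsilon> * norm (y - snd z)})
        \<union> (\<Union>y\<in>A. {z. dist y (snd z) < \<delta> \<and> (y - snd z) \<bullet> fst z > \<epsilon> * norm (y - snd z)})"
      by (auto simp: C_def)
    moreover have "open \<dots>"
      by (intro open_Un open_UN ballI open_Collect_conj open_Collect_less continuous_intros)
    ultimately show ?thesis by (simp add: closed_def)
  qed
  have borel: "{x. \<exists>n\<in>B. is_outward_normal A x n} \<in> sets borel" if "closed B" for B
  proof -
    let ?S = "sphere 0 1 \<inter> B"
    have S: "compact ?S" using that by (simp add: compact_Int_closed)
    have iff: "(\<exists>n\<in>B. is_outward_normal A x n) \<longleftrightarrow>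
        (\<forall>k. \<exists>m. \<exists>n. n \<in> ?S \<and> (n, x) \<in> C (1 / real (Suc k)) (1 / real (Suc m)))" (is "?l \<longleftrightarrow> ?r") for x
    proof
      assume ?l
      then obtain n where n: "n \<in> B" "is_outward_normal A x n" by blast
      then have "n \<in> ?S" by (simp add: is_outward_normal_def)
      moreover have "\<exists>m. (n, x) \<in> C (1 / real (Suc k)) (1 / real (Suc m))" for k
      proof -
        have "0 < 1 / real (Suc k)" by simp
        with n(2) obtain \<delta> where "0 < \<delta>" and \<delta>: "\<And>y. dist y x < \<delta> \<Longrightarrow>
            ((y - x) \<bullet> n < - (1 / real (Suc k)) * norm (y - x) \<longrightarrow> y \<in> A) \<and>
            ((y - x) \<bullet> n > 1 / real (Suc k) * norm (y - x) \<longrightarrow> y \<notin> A)"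
          unfolding is_outward_normal_def by blast
        from nat_approx_posE[OF \<open>0 < \<delta>\<close>] obtain m where "1 / real (Suc m) < \<delta>" by auto
        then show ?thesis using \<delta> by (intro exI[of _ m]) (auto simp: C_def)
      qed
      ultimately show ?r by blast
    next
      assume ?r
      then obtain m n where n: "\<And>k. n k \<in> ?S" and C: "\<And>k. (n k, x) \<in> C (1 / real (Suc k)) (1 / real (Suc (m k)))"
        by metis
      \<comment> \<open>approximate normals for \<open>\<epsilon> = 1 / Suc k\<close> accumulate at a genuine one\<close>
      from S n obtain N r where N: "N \<in> ?S" and r: "strict_mono r" "(n \<circ> r) \<longlonglongrightarrow> N"
        unfolding compact_def by blast
      have "is_outward_normal A x N"
        unfolding is_outward_normal_def
      proof (intro conjI allI impI)
        show "norm N = 1" using N by simp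
        fix \<epsilon> :: real assume \<epsilon>: "0 < \<epsilon>"
        have "eventually (\<lambda>k. dist ((n \<circ> r) k) N < \<epsilon> / 2) sequentially"
          by (rule tendstoD[OF r(2)]) (use \<epsilon> in simp)
        moreover have "eventually (\<lambda>k. 1 / real (Suc k) < \<epsilon> / 2) sequentially"
          using order_tendstoD(2)[OF LIMSEQ_inverse_real_of_nat, of "\<epsilon> / 2"] \<epsilon>
          by (simp add: inverse_eq_divide)
        ultimately have "eventually (\<lambda>k. dist ((n \<circ> r) k) N < \<epsilon> / 2 \<and> 1 / real (Suc k) < \<epsilon> / 2) sequentially"
          by (rule eventually_conj)
        then obtain k where k: "dist (n (r k)) N < \<epsilon> / 2" "1 / real (Suc k) < \<epsilon> / 2"
          by (auto dest: eventually_happens)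
        have "1 / real (Suc (r k)) \<le> 1 / real (Suc k)"
          using seq_suble[OF r(1), of k] by (simp add: field_simps)
        with k have k': "1 / real (Suc (r k)) < \<epsilon> / 2" by simp
        define \<delta> where "\<delta> = 1 / real (Suc (m (r k)))"
        have "((y - x) \<bullet> N < - \<epsilon> * norm (y - x) \<longrightarrow> y \<in> A) \<and> ((y - x) \<bullet> N > \<epsilon> * norm (y - x) \<longrightarrow> y \<notin> A)"
          if "dist y x < \<delta>" for y
        proof -
          have "\<bar>(y - x) \<bullet> (n (r k) - N)\<bar> \<le> norm (y - x) * norm (n (r k) - N)"
            by (rule Cauchy_Schwarz_ineq2)
          also have "\<dots> \<le> norm (y - x) * (\<epsilon> / 2)"
            using k by (intro mult_left_mono) (auto simp: dist_norm)
          finally have "\<bar>(y - x) \<bullet> n (r k) - (y - x) \<bullet> N\<bar> \<le> \<epsilon> / 2 * norm (y - x)"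
            by (simp add: inner_diff_right mult.commute)
          then have "\<bar>(y - x) \<bullet> n (r k) - (y - x) \<bullet> N\<bar> \<le> (\<epsilon> * norm (y - x)) / 2"
            by simp
          moreover have "1 / real (Suc (r k)) * norm (y - x) \<le> \<epsilon> / 2 * norm (y - x)"
            using k' by (intro mult_right_mono) auto
          then have "1 / real (Suc (r k)) * norm (y - x) \<le> (\<epsilon> * norm (y - x)) / 2"
            by simp
          moreover have "((y - x) \<bullet> n (r k) < - (1 / real (Suc (r k)) * norm (y - x)) \<longrightarrow> y \<in> A) \<and>
              ((y - x) \<bullet> n (r k) > 1 / real (Suc (r k)) * norm (y - x) \<longrightarrow> y \<notin> A)"
            using C[of "r k"] that by (simp add: C_def \<delta>_def)
          ultimately show ?thesis
            unfolding mult_minus_left by (intro conjI impI; elim conjE mp; linarith)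
        qed
        then show "\<exists>\<delta>>0. \<forall>y. dist y x < \<delta> \<longrightarrow>
            ((y - x) \<bullet> N < - \<epsilon> * norm (y - x) \<longrightarrow> y \<in> A) \<and> ((y - x) \<bullet> N > \<epsilon> * norm (y - x) \<longrightarrow> y \<notin> A)"
          by (intro exI[of _ \<delta>]) (simp add: \<delta>_def)
      qed
      with N show ?l by blast
    qed
    then have "{x. \<exists>n\<in>B. is_outward_normal A x n} =
        (\<Inter>k. \<Union>m. {x. \<exists>n. n \<in> ?S \<and> (n, x) \<in> C (1 / real (Suc k)) (1 / real (Suc m))})"
      by (intro set_eqI) (simp only: mem_Collect_eq iff INT_iff UN_iff UNIV_I simp_thms bex_UNIV ball_UNIV)
    also have "\<dots> \<in> sets borel"
      by (intro sets.countable_INT'' sets.countable_UN image_subsetI borel_closed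
          closed_compact_projection[OF S closed_C]) simp_all
    finally show ?thesis .
  qed
  have closed: "{x. outward_normal A x \<in> B} \<in> sets borel" if "closed B" for B
  proof -
    let ?T = "\<lambda>B. {x. \<exists>n\<in>B. is_outward_normal A x n}"
    have "{x. outward_normal A x \<in> B} = ?T B \<union> (if 0 \<in> B then - ?T UNIV else {})"
    proof (rule set_eqI)
      fix x
      show "x \<in> {x. outward_normal A x \<in> B} \<longleftrightarrow> x \<in> ?T B \<union> (if 0 \<in> B then - ?T UNIV else {})"
      proof (cases "\<exists>n. is_outward_normal A x n")
        case True
        then obtain n where n: "is_outward_normal A x n" by blast
        then have "is_outward_normal A x n' \<longleftrightarrow> n' = n" for n'
          using outward_normal_unique by blast
        then show ?thesis using outward_normal_eqI[OF n] by simp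
      next
        case False
        then have "outward_normal A x = 0" by (simp add: outward_normal_def)
        with False show ?thesis by simp
      qed
    qed
    moreover have "- ?T UNIV \<in> sets borel"
      using sets.compl_sets[OF borel[OF closed_UNIV]] by (simp add: Compl_eq_Diff_UNIV)
    ultimately show ?thesis using borel[OF that] by simp
  qed
  show ?thesis
  proof (rule borel_measurableI)
    fix U :: "'a set" assume "open U"
    then have "{x. outward_normal A x \<in> - U} \<in> sets borel" by (intro closed) auto
    from sets.compl_sets[OF this] show "outward_normal A -` U \<inter> space borel \<in> sets borel"
      by (simp add: Compl_eq_Diff_UNIV[symmetric] vimage_def Collect_neg_eq[symmetric])
  qed
qed

lemma bounded_borel_outward_normal: "bounded_borel (outward_normal A)"
  by (intro bounded_borelI borel_measurable_outward_normal exI[of _ 1] ballI norm_outward_normal_le)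

lemmas bounded_borel_intros = bounded_borel_add bounded_borel_diff bounded_borel_mult
  bounded_borel_scaleR bounded_borel_inner bounded_borel_const bounded_borel_outward_normal


section \<open>Cells of a Cartesian grid\<close>

definition grid_cell :: "('a::euclidean_space \<Rightarrow> real set) \<Rightarrow> 'a \<Rightarrow> 'a \<Rightarrow> bool" where
  "grid_cell G a b \<longleftrightarrow> (\<forall>i\<in>Basis. a \<bullet> i \<in> G i \<and> b \<bullet> i \<in> G i \<and> a \<bullet> i < b \<bullet> i \<and>
     (\<forall>g\<in>G i. \<not> (a \<bullet> i < g \<and> g < b \<bullet> i)))"

lemma cartesian_mesh_grid_cell:
  "cartesian_mesh \<T> \<longleftrightarrow> (\<exists>G. (\<forall>i\<in>Basis. finite (G i)) \<and> \<T> = {cbox a b | a b. grid_cell G a b})"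
  unfolding cartesian_mesh_def grid_cell_def ..

lemma finite_cartesian_mesh:
  assumes "cartesian_mesh \<T>"
  shows "finite \<T>"
proof -
  obtain G where fin: "\<forall>i\<in>Basis. finite (G i)" and \<T>: "\<T> = {cbox a b | a b. grid_cell G a b}"
    using assms unfolding cartesian_mesh_grid_cell by blast
  let ?P = "Pi\<^sub>E Basis G"
  let ?v = "\<lambda>f. \<Sum>i\<in>Basis. f i *\<^sub>R i"
  have v: "a \<in> ?v ` ?P" if "\<forall>i\<in>Basis. a \<bullet> i \<in> G i" for a
  proof
    show "a = ?v (restrict (\<lambda>i. a \<bullet> i) Basis)" by (simp add: euclidean_representation)
    show "restrict (\<lambda>i. a \<bullet> i) Basis \<in> ?P" using that by simp
  qed
  have "\<T> \<subseteq> (\<lambda>(a, b). cbox a b) ` (?v ` ?P \<times> ?v ` ?P)"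
    using v by (force simp: \<T> grid_cell_def)
  moreover have "finite ?P" using fin by (intro finite_PiE) auto
  ultimately show ?thesis by (blast intro: finite_subset)
qed

text \<open>\<open>x\<close> lies in the relative interior of a side of the box, orthogonal to the coordinate
  direction \<open>i\<close>, on which the outward normal is \<open>m\<close>.\<close>

definition on_flat_side :: "'a::euclidean_space \<Rightarrow> 'a \<Rightarrow> 'a \<Rightarrow> 'a \<Rightarrow> 'a \<Rightarrow> bool" where
  "on_flat_side a b i m x \<longleftrightarrow> i \<in> Basis \<and> (\<forall>j\<in>Basis - {i}. a \<bullet> j < x \<bullet> j \<and> x \<bullet> j < b \<bullet> j) \<and>
     (x \<bullet> i = a \<bullet> i \<and> m = - i \<or> x \<bullet> i = b \<bullet> i \<and> m = i)"

lemma norm_flat_side: "on_flat_side a b i m x \<Longrightarrow> norm m = 1"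
  by (auto simp: on_flat_side_def)

text \<open>A side through \<open>x\<close> supports the box, which forces the normal to be that of the side. On an edge two
  sides would force two different normals.\<close>

lemma outward_normal_cbox_flat:
  fixes a b x :: "'a::euclidean_space"
  assumes x: "x \<in> frontier (cbox a b)" and nz: "outward_normal (cbox a b) x \<noteq> 0"
  obtains i where "on_flat_side a b i (outward_normal (cbox a b) x) x"
proof -
  define n where "n = outward_normal (cbox a b) x"
  have n: "is_outward_normal (cbox a b) x n"
    unfolding n_def using nz by (rule is_outward_normal_outward_normal)
  have box: "x \<in> cbox a b" "x \<notin> box a b"
    using x by (auto simp: frontier_cbox)
  have lower: "n = - j" if "j \<in> Basis" "x \<bullet> j = a \<bullet> j" for j
    using n by (rule outward_normal_supporting) (use that in \<open>auto simp: mem_box inner_diff_left\<close>)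
  have upper: "n = j" if "j \<in> Basis" "x \<bullet> j = b \<bullet> j" for j
    using n by (rule outward_normal_supporting) (use that in \<open>auto simp: mem_box inner_diff_left\<close>)
  obtain i where i: "i \<in> Basis" "x \<bullet> i = a \<bullet> i \<or> x \<bullet> i = b \<bullet> i"
    using box by (force simp: mem_box)
  then have ni: "x \<bullet> i = a \<bullet> i \<and> n = - i \<or> x \<bullet> i = b \<bullet> i \<and> n = i"
    using lower upper by blast
  then have "n \<bullet> i \<noteq> 0" using i by (auto simp: inner_Basis)
  have "a \<bullet> j < x \<bullet> j \<and> x \<bullet> j < b \<bullet> j" if j: "j \<in> Basis - {i}" for j
  proof (rule ccontr)
    assume "\<not> (a \<bullet> j < x \<bullet> j \<and> x \<bullet> j < b \<bullet> j)"
    then have "x \<bullet> j = a \<bullet> j \<or> x \<bullet> j = b \<bullet> j"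
      using box(1) j by (force simp: mem_box)
    then have "n = - j \<or> n = j" using lower upper j by blast
    then have "n \<bullet> i = 0" using i j by (auto simp: inner_Basis)
    with \<open>n \<bullet> i \<noteq> 0\<close> show False ..
  qed
  with i ni show ?thesis
    by (intro that[of i]) (simp add: on_flat_side_def flip: n_def)
qed

lemma flat_side_half_space:
  assumes flat: "on_flat_side a b i m x" and ab: "\<And>j. j \<in> Basis \<Longrightarrow> a \<bullet> j < b \<bullet> j"
  obtains d where "0 < d" "\<And>y. dist y x < d \<Longrightarrow> y \<in> cbox a b \<longleftrightarrow> (y - x) \<bullet> m \<le> 0"
proof -
  have i: "i \<in> Basis" and m: "x \<bullet> i = a \<bullet> i \<and> m = - i \<or> x \<bullet> i = b \<bullet> i \<and> m = i"
    and x: "\<And>j. j \<in> Basis - {i} \<Longrightarrow> a \<bullet> j < x \<bullet> j \<and> x \<bullet> j < b \<bullet> j"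
    using flat by (auto simp: on_flat_side_def)
  let ?U = "\<Inter>j\<in>Basis - {i}. {y. a \<bullet> j < y \<bullet> j \<and> y \<bullet> j < b \<bullet> j}"
  have "open ?U"
    by (intro open_INT ballI open_Collect_conj open_Collect_less continuous_intros) auto
  moreover have "x \<in> ?U" using x by blast
  ultimately obtain e where e: "0 < e" "\<And>y. dist y x < e \<Longrightarrow> y \<in> ?U"
    unfolding open_dist by blast
  show ?thesis
  proof (rule that[of "min e (b \<bullet> i - a \<bullet> i)"])
    show "0 < min e (b \<bullet> i - a \<bullet> i)" using e ab[OF i] by simp
    fix y assume y: "dist y x < min e (b \<bullet> i - a \<bullet> i)"
    then have U: "y \<in> ?U" by (intro e(2)) simp
    have "\<bar>(y - x) \<bullet> i\<bar> < b \<bullet> i - a \<bullet> i"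
      using Basis_le_norm[OF i, of "y - x"] y by (simp add: dist_norm)
    then have yi: "\<bar>y \<bullet> i - x \<bullet> i\<bar> < b \<bullet> i - a \<bullet> i" by (simp add: inner_diff_left)
    have "y \<in> cbox a b \<longleftrightarrow> a \<bullet> i \<le> y \<bullet> i \<and> y \<bullet> i \<le> b \<bullet> i"
    proof
      assume *: "a \<bullet> i \<le> y \<bullet> i \<and> y \<bullet> i \<le> b \<bullet> i"
      have "a \<bullet> j \<le> y \<bullet> j \<and> y \<bullet> j \<le> b \<bullet> j" if "j \<in> Basis" for j
        using * U that by (cases "j = i") (auto intro: less_imp_le)
      then show "y \<in> cbox a b" by (simp add: mem_box)
    qed (use i in \<open>simp add: mem_box\<close>)
    also have "\<dots> \<longleftrightarrow> (y - x) \<bullet> m \<le> 0"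
      using m
    proof
      assume "x \<bullet> i = a \<bullet> i \<and> m = - i"
      with yi show ?thesis by (auto simp: inner_diff_left)
    next
      assume "x \<bullet> i = b \<bullet> i \<and> m = i"
      with yi show ?thesis by (auto simp: inner_diff_left)
    qed
    finally show "y \<in> cbox a b \<longleftrightarrow> (y - x) \<bullet> m \<le> 0" .
  qed
qed

lemma flat_side_frontier:
  assumes flat: "on_flat_side a b i m x" and ab: "\<And>j. j \<in> Basis \<Longrightarrow> a \<bullet> j < b \<bullet> j"
  obtains d where "0 < d" "\<And>y. dist y x < d \<Longrightarrow> (y - x) \<bullet> i = 0 \<Longrightarrow> y \<in> frontier (cbox a b)"
proof -
  obtain d where d: "0 < d" "\<And>y. dist y x < d \<Longrightarrow> y \<in> cbox a b \<longleftrightarrow> (y - x) \<bullet> m \<le> 0"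
    using flat_side_half_space[OF flat ab] by blast
  have "y \<in> frontier (cbox a b)" if "dist y x < d" "(y - x) \<bullet> i = 0" for y
  proof -
    have "y \<in> cbox a b" using d(2)[OF that(1)] that(2) flat by (auto simp: on_flat_side_def)
    moreover have "y \<notin> box a b"
      using that(2) flat by (force simp: on_flat_side_def mem_box inner_diff_left)
    ultimately show ?thesis by (simp add: frontier_cbox)
  qed
  with d(1) show ?thesis by (rule that)
qed

lemma outward_normal_flat_side:
  assumes flat: "on_flat_side a b i m x" and ab: "\<And>j. j \<in> Basis \<Longrightarrow> a \<bullet> j < b \<bullet> j"
  shows "outward_normal (cbox a b) x = m"
proof -
  obtain d where "0 < d" "\<And>y. dist y x < d \<Longrightarrow> y \<in> cbox a b \<longleftrightarrow> (y - x) \<bullet> m \<le> 0"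
    using flat_side_half_space[OF flat ab] by blast
  then show ?thesis
    by (intro outward_normal_eqI is_outward_normal_half_space[of d] norm_flat_side[OF flat])
qed

text \<open>The end points of the sides of a cell are consecutive grid coordinates. In the directions in which
  \<open>x\<close> is strictly between two of them, a second cell through \<open>x\<close> has the same end points; in the
  direction \<open>i\<close>, in which \<open>x\<close> is on a grid plane, it is either the same cell or the next one beyond
  that plane.\<close>

lemma grid_cell_opposite:
  fixes a b a' b' :: "'a::euclidean_space"
  assumes cell: "grid_cell G a b" and cell': "grid_cell G a' b'"
    and flat: "on_flat_side a b i m x" and x: "x \<in> cbox a' b'" and ne: "cbox a' b' \<noteq> cbox a b"
  shows "on_flat_side a' b' i (- m) x"
proof -
  have i: "i \<in> Basis" and m: "x \<bullet> i = a \<bullet> i \<and> m = - i \<or> x \<bullet> i = b \<bullet> i \<and> m = i"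
    and between: "\<And>j. j \<in> Basis - {i} \<Longrightarrow> a \<bullet> j < x \<bullet> j \<and> x \<bullet> j < b \<bullet> j"
    using flat by (auto simp: on_flat_side_def)
  have G: "a \<bullet> j \<in> G j" "b \<bullet> j \<in> G j" "a \<bullet> j < b \<bullet> j" "\<And>g. g \<in> G j \<Longrightarrow> g \<le> a \<bullet> j \<or> b \<bullet> j \<le> g"
    "a' \<bullet> j \<in> G j" "b' \<bullet> j \<in> G j" "a' \<bullet> j < b' \<bullet> j" "\<And>g. g \<in> G j \<Longrightarrow> g \<le> a' \<bullet> j \<or> b' \<bullet> j \<le> g"
    "a' \<bullet> j \<le> x \<bullet> j" "x \<bullet> j \<le> b' \<bullet> j" if "j \<in> Basis" for j
    using cell cell' x that by (force simp: grid_cell_def mem_box not_le)+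
  have same: "a' \<bullet> j = a \<bullet> j \<and> b' \<bullet> j = b \<bullet> j" if "j \<in> Basis - {i}" for j
  proof -
    have j: "j \<in> Basis" using that by blast
    show ?thesis
      using between[OF that] G(4)[OF j G(5)[OF j]] G(4)[OF j G(6)[OF j]] G(8)[OF j G(1)[OF j]]
        G(8)[OF j G(2)[OF j]] G(9,10)[OF j]
      by argo
  qed
  have "\<not> (a' \<bullet> i = a \<bullet> i \<and> b' \<bullet> i = b \<bullet> i)"
  proof
    assume "a' \<bullet> i = a \<bullet> i \<and> b' \<bullet> i = b \<bullet> i"
    then have "a' \<bullet> j = a \<bullet> j" "b' \<bullet> j = b \<bullet> j" if "j \<in> Basis" for j
      using same[of j] that by (cases "j = i", auto)+
    then have "a' = a" "b' = b" by (auto intro: euclidean_eqI)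
    with ne show False by simp
  qed
  then have "x \<bullet> i = b' \<bullet> i \<and> - m = i \<or> x \<bullet> i = a' \<bullet> i \<and> - m = - i"
    using m
  proof (elim disjE conjE)
    assume *: "x \<bullet> i = a \<bullet> i" "m = - i" "\<not> (a' \<bullet> i = a \<bullet> i \<and> b' \<bullet> i = b \<bullet> i)"
    then have "x \<bullet> i = b' \<bullet> i"
      using G(3,7,9,10)[OF i] G(4)[OF i G(6)[OF i]] G(8)[OF i G(1)[OF i]] G(8)[OF i G(2)[OF i]] by argo
    with * show ?thesis by simp
  next
    assume *: "x \<bullet> i = b \<bullet> i" "m = i" "\<not> (a' \<bullet> i = a \<bullet> i \<and> b' \<bullet> i = b \<bullet> i)"
    then have "x \<bullet> i = a' \<bullet> i"
      using G(3,7,9,10)[OF i] G(4)[OF i G(5)[OF i]] G(8)[OF i G(1)[OF i]] G(8)[OF i G(2)[OF i]] by argo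
    with * show ?thesis by simp
  qed
  with i same between show ?thesis by (auto simp: on_flat_side_def)
qed

lemma flat_side_not_both:
  assumes "on_flat_side a b i m x" "on_flat_side a b i (- m) x" "a \<bullet> i < b \<bullet> i"
  shows False
proof -
  have "i \<bullet> i = 1" using assms(1) by (simp add: on_flat_side_def)
  moreover have "i \<bullet> i = - (i \<bullet> i)" if "i = - i" using arg_cong[OF that, of "\<lambda>j. j \<bullet> i"] by simp
  ultimately have "i \<noteq> - i" by force
  with assms show False by (auto simp: on_flat_side_def)
qed

lemma grid_cell_neighbour_unique:
  fixes a b :: "'a::euclidean_space"
  assumes "grid_cell G a b" "grid_cell G a1 b1" "grid_cell G a2 b2"
    and "on_flat_side a b i m x" "x \<in> cbox a1 b1" "x \<in> cbox a2 b2"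
    and "cbox a1 b1 \<noteq> cbox a b" "cbox a2 b2 \<noteq> cbox a b"
  shows "cbox a2 b2 = cbox a1 b1"
proof (rule ccontr)
  assume ne: "cbox a2 b2 \<noteq> cbox a1 b1"
  have 1: "on_flat_side a1 b1 i (- m) x" and 2: "on_flat_side a2 b2 i (- m) x"
    using assms by (blast intro: grid_cell_opposite)+
  from grid_cell_opposite[OF assms(2,3) 1 assms(6) ne] have "on_flat_side a2 b2 i m x" by simp
  moreover have "a2 \<bullet> i < b2 \<bullet> i"
    using assms(3) 2 by (simp add: grid_cell_def on_flat_side_def)
  ultimately show False using 2 flat_side_not_both by blast
qed

text \<open>A step out of \<open>K\<close> that is too short to leave \<open>\<Omega>\<close>, or to reach a cell that does not contain \<open>x\<close>,
  ends in a cell that contains \<open>x\<close>.\<close>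

lemma neighbour_exists:
  fixes \<T> :: "'a::euclidean_space set set"
  assumes "finite \<T>" "\<And>K. K \<in> \<T> \<Longrightarrow> closed K" "open \<Omega>" "\<Omega> \<subseteq> \<Union>\<T>" "x \<in> \<Omega>"
    and "0 < d" "\<And>y. dist y x < d \<Longrightarrow> y \<in> K \<longleftrightarrow> (y - x) \<bullet> m \<le> 0" "norm m = 1"
  obtains K' where "K' \<in> \<T>" "K' \<noteq> K" "x \<in> K'"
proof -
  have "closed (\<Union>{L \<in> \<T>. x \<notin> L})" using assms(1,2) by (intro closed_Union) auto
  then have "open (\<Omega> - \<Union>{L \<in> \<T>. x \<notin> L})" using assms(3) by (rule open_Diff[rotated])
  moreover have "x \<in> \<Omega> - \<Union>{L \<in> \<T>. x \<notin> L}" using assms(5) by blast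
  ultimately obtain e where e: "0 < e" "\<And>y. dist y x < e \<Longrightarrow> y \<in> \<Omega> - \<Union>{L \<in> \<T>. x \<notin> L}"
    unfolding open_dist by blast
  define s where "s = min d e / 2"
  define y where "y = x + s *\<^sub>R m"
  have s: "0 < s" "s < d" "s < e" using assms(6) e by (auto simp: s_def min_def)
  have dist: "dist y x = s" using s assms(8) by (simp add: y_def dist_norm)
  have "(y - x) \<bullet> m = s" using assms(8) by (simp add: y_def norm_eq_1)
  with s dist assms(7)[of y] have "y \<notin> K" by simp
  moreover have "y \<in> \<Omega> - \<Union>{L \<in> \<T>. x \<notin> L}" using e(2) s dist by simp
  ultimately show ?thesis using assms(4) that by blast
qed


section \<open>Interior faces of a cut mesh\<close>

lemma cell_of_mesh:
  assumes "valid_cut_mesh M" "K \<in> bg_mesh M"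
  shows "closed K" "bounded K" "emeasure surface_measure (frontier K) < \<infinity>"
  using assms emeasure_surface_frontier_cbox
  by (auto simp: valid_cut_mesh_def cartesian_mesh_grid_cell)

lemma finite_active_mesh:
  assumes "valid_cut_mesh M"
  shows "finite (active_mesh M)"
  using finite_cartesian_mesh[of "bg_mesh M"] assms by (auto simp: valid_cut_mesh_def active_mesh_def)

lemma active_mesh_bg: "K \<in> active_mesh M \<Longrightarrow> K \<in> bg_mesh M"
  by (simp add: active_mesh_def)

lemma finite_interior_faces:
  assumes "valid_cut_mesh M"
  shows "finite (interior_faces M)"
proof (rule finite_subset)
  show "interior_faces M \<subseteq> (\<lambda>(K, K'). frontier K \<inter> frontier K') ` (active_mesh M \<times> active_mesh M)"
    by (auto simp: interior_faces_def)
qed (use finite_active_mesh[OF assms] in auto)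

lemma valid_cut_mesh_face:
  assumes "valid_cut_mesh M" "F \<in> interior_faces M"
  shows "Kplus M F \<in> active_mesh M" "Kminus M F \<in> active_mesh M" "Kplus M F \<noteq> Kminus M F"
    and "F = frontier (Kplus M F) \<inter> frontier (Kminus M F)"
proof -
  have "\<forall>F\<in>interior_faces M. Kplus M F \<in> active_mesh M \<and> Kminus M F \<in> active_mesh M \<and>
      Kplus M F \<noteq> Kminus M F \<and> F = frontier (Kplus M F) \<inter> frontier (Kminus M F) \<and>
      norm (face_normal M F) = 1 \<and> (\<forall>x\<in>F. \<forall>y\<in>F. (x - y) \<bullet> face_normal M F = 0)"
    using assms(1) unfolding valid_cut_mesh_def by (elim conjE)
  note * = bspec[OF this assms(2)]
  show "Kplus M F \<in> active_mesh M" using * by (elim conjE)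
  show "Kminus M F \<in> active_mesh M" using * by (elim conjE)
  show "Kplus M F \<noteq> Kminus M F" using * by (elim conjE)
  show "F = frontier (Kplus M F) \<inter> frontier (Kminus M F)" using * by (elim conjE)
qed

text \<open>The neighbour is active because \<open>x\<close> is in the closure of its interior, which therefore meets the
  open set \<open>domain M\<close>. Near \<open>x\<close> the common frontier of the two cells contains a neighbourhood of \<open>x\<close> in
  a coordinate hyperplane; this makes its measure positive.\<close>

lemma neighbour_across_face:
  fixes M :: "'a::euclidean_space cut_mesh"
  assumes M: "valid_cut_mesh M" and K: "K \<in> active_mesh M"
    and x: "x \<in> frontier K" "x \<in> domain M" "outward_normal K x \<noteq> 0"
  obtains K' where "K' \<in> active_mesh M" "K' \<noteq> K" "x \<in> frontier K'"
    and "norm (outward_normal K x) = 1" "outward_normal K' x = - outward_normal K x"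
    and "\<And>L. L \<in> bg_mesh M \<Longrightarrow> x \<in> L \<Longrightarrow> L = K \<or> L = K'"
    and "0 < hausdorff_outer (DIM('a) - 1) (frontier K \<inter> frontier K' \<inter> domain M)"
proof -
  have \<Omega>: "open (domain M)" "domain M \<subseteq> \<Union>(bg_mesh M)"
    using M by (auto simp: valid_cut_mesh_def bounded_domain_def)
  obtain G where \<T>: "bg_mesh M = {cbox a b | a b. grid_cell G a b}"
    using M by (auto simp: valid_cut_mesh_def cartesian_mesh_grid_cell)
  obtain a b where K_eq: "K = cbox a b" and cell: "grid_cell G a b"
    using K \<T> by (auto simp: active_mesh_def)
  have less: "c \<bullet> j < d \<bullet> j" if "grid_cell G c d" "j \<in> Basis" for c d j
    using that by (auto simp: grid_cell_def)
  define m where "m = outward_normal K x"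
  obtain i where flat: "on_flat_side a b i m x"
    using outward_normal_cbox_flat x unfolding K_eq m_def by metis
  have i: "i \<in> Basis" using flat by (simp add: on_flat_side_def)
  obtain d where d: "0 < d" "\<And>y. dist y x < d \<Longrightarrow> y \<in> K \<longleftrightarrow> (y - x) \<bullet> m \<le> 0"
    using flat_side_half_space[OF flat less[OF cell]] unfolding K_eq by blast
  obtain K' where K': "K' \<in> bg_mesh M" "K' \<noteq> K" "x \<in> K'"
  proof (rule neighbour_exists[OF _ _ \<Omega> x(2) d norm_flat_side[OF flat]])
    show "finite (bg_mesh M)" using M by (simp add: valid_cut_mesh_def finite_cartesian_mesh)
    show "closed L" if "L \<in> bg_mesh M" for L using cell_of_mesh[OF M that] by simp
  qed
  then obtain a' b' where K'_eq: "K' = cbox a' b'" and cell': "grid_cell G a' b'"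
    using \<T> by auto
  have flat': "on_flat_side a' b' i (- m) x"
    using grid_cell_opposite[OF cell cell' flat] K' by (simp add: K_eq K'_eq)
  obtain e where e: "0 < e" "\<And>y. dist y x < e \<Longrightarrow> (y - x) \<bullet> i = 0 \<Longrightarrow> y \<in> frontier K"
    using flat_side_frontier[OF flat less[OF cell]] unfolding K_eq by blast
  obtain e' where e': "0 < e'" "\<And>y. dist y x < e' \<Longrightarrow> (y - x) \<bullet> i = 0 \<Longrightarrow> y \<in> frontier K'"
    using flat_side_frontier[OF flat' less[OF cell']] unfolding K'_eq by blast
  obtain r where r: "0 < r" "\<And>y. dist y x < r \<Longrightarrow> y \<in> domain M"
    using \<Omega>(1) x(2) unfolding open_dist by blast
  show ?thesis
  proof (rule that[of K'])
    have "box a' b' \<inter> domain M \<noteq> {}"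
    proof -
      have "box a' b' \<noteq> {}" using less[OF cell'] by (simp add: box_ne_empty)
      then have "x \<in> closure (box a' b')"
        using K'(3) by (simp add: closure_box K'_eq)
      with \<Omega>(1) x(2) show ?thesis using open_Int_closure_eq_empty[of "domain M" "box a' b'"] by blast
    qed
    then have "\<not> negligible (box a' b' \<inter> domain M)"
      using \<Omega>(1) by (intro open_not_negligible) auto
    moreover have "negligible (K' \<inter> domain M)" if "emeasure lborel (K' \<inter> domain M) = 0"
    proof -
      have "K' \<inter> domain M \<in> null_sets lborel"
        using that \<Omega>(1) by (intro null_setsI) (auto simp: K'_eq)
      then show ?thesis
        by (simp add: negligible_iff_null_sets null_sets_completionI)
    qed
    ultimately have "emeasure lborel (K' \<inter> domain M) \<noteq> 0"
      using negligible_subset[of "K' \<inter> domain M" "box a' b' \<inter> domain M"] box_subset_cbox[of a' b']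
      by (auto simp: K'_eq)
    then show "K' \<in> active_mesh M"
      using K'(1) by (simp add: active_mesh_def zero_less_iff_neq_zero)
    show "x \<in> frontier K'" using e' by simp
    show "norm (outward_normal K x) = 1" using norm_flat_side[OF flat] by (simp add: m_def)
    show "outward_normal K' x = - outward_normal K x"
      using outward_normal_flat_side[OF flat' less[OF cell']] by (simp add: K'_eq flip: m_def)
    show "L = K \<or> L = K'" if "L \<in> bg_mesh M" "x \<in> L" for L
      using that K' grid_cell_neighbour_unique[OF cell cell' _ flat] \<T> by (auto simp: K_eq K'_eq)
    show "0 < hausdorff_outer (DIM('a) - 1) (frontier K \<inter> frontier K' \<inter> domain M)"
    proof (rule hausdorff_outer_hyperplane_pos[OF i])
      show "0 < min e (min e' r)" using e e' r by simp
      show "{y \<in> ball x (min e (min e' r)). (y - x) \<bullet> i = 0} \<subseteq> frontier K \<inter> frontier K' \<inter> domain M"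
        using e(2) e'(2) r(2) by (auto simp: dist_commute)
    qed
  qed (use K' in auto)
qed

text \<open>At these points the definite description in \<open>face_at\<close> is meaningful: a face contains \<open>x\<close> only if
  it is the common frontier of the two cells that meet there.\<close>

lemma face_at_neighbours:
  fixes M :: "'a::euclidean_space cut_mesh"
  assumes M: "valid_cut_mesh M"
    and hausdorff: "\<forall>A\<in>sets (borel :: 'a measure). emeasure surface_measure A = hausdorff_outer (DIM('a) - 1) A"
    and K: "K \<in> active_mesh M" and x: "x \<in> frontier K" "x \<in> domain M" "outward_normal K x \<noteq> 0"
  obtains K' where "face_at M x \<in> interior_faces M" "x \<in> face_at M x"
    and "\<And>F. F \<in> interior_faces M \<Longrightarrow> x \<in> F \<Longrightarrow> F = face_at M x"
    and "K' \<in> active_mesh M" "K' \<noteq> K" "x \<in> frontier K'"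
    and "norm (outward_normal K x) = 1" "outward_normal K' x = - outward_normal K x"
    and "\<And>L. L \<in> active_mesh M \<Longrightarrow> x \<in> frontier L \<Longrightarrow> L = K \<or> L = K'"
    and "Kplus M (face_at M x) = K \<and> Kminus M (face_at M x) = K' \<or>
      Kplus M (face_at M x) = K' \<and> Kminus M (face_at M x) = K"
proof -
  obtain K' where K': "K' \<in> active_mesh M" "K' \<noteq> K" "x \<in> frontier K'"
    "norm (outward_normal K x) = 1" "outward_normal K' x = - outward_normal K x"
    and two: "\<And>L. L \<in> bg_mesh M \<Longrightarrow> x \<in> L \<Longrightarrow> L = K \<or> L = K'"
    and pos: "0 < hausdorff_outer (DIM('a) - 1) (frontier K \<inter> frontier K' \<inter> domain M)"
    by (rule neighbour_across_face[OF M K x]) (rule that)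
  have two': "L = K \<or> L = K'" if "L \<in> active_mesh M" "x \<in> frontier L" for L
    using two[of L] that cell_of_mesh(1)[OF M, of L] frontier_subset_closed by (blast dest: active_mesh_bg)
  let ?F = "frontier K \<inter> frontier K'"
  have "open (domain M)" using M by (auto simp: valid_cut_mesh_def bounded_domain_def)
  then have pos': "0 < emeasure surface_measure (?F \<inter> domain M)"
    using pos by (subst hausdorff[rule_format]) (auto intro!: borel_open borel_closed)
  also have "\<dots> \<le> emeasure surface_measure ?F"
    by (intro emeasure_mono) auto
  finally have F: "?F \<in> interior_faces M"
    unfolding interior_faces_def using K K' by blast
  have unique: "F = ?F" if F': "F \<in> interior_faces M" "x \<in> F" for F
  proof -
    obtain L L' where L: "F = frontier L \<inter> frontier L'" "L \<in> active_mesh M" "L' \<in> active_mesh M" "L \<noteq> L'"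
      using F'(1) by (auto simp: interior_faces_def)
    with F'(2) two'[of L] two'[of L'] show ?thesis by auto
  qed
  have F_at: "face_at M x = ?F"
    unfolding face_at_def
  proof (rule the_equality)
    show "?F \<in> interior_faces M \<and> ?F \<inter> domain M \<in> cut_faces M \<and> x \<in> ?F"
      using F pos' x K' by (auto simp: cut_faces_def)
  qed (use unique in blast)
  note face = valid_cut_mesh_face[OF M F]
  have "x \<in> frontier (Kplus M ?F)" "x \<in> frontier (Kminus M ?F)"
    using face(4) x(1) K'(3) by blast+
  then have "Kplus M ?F = K \<and> Kminus M ?F = K' \<or> Kplus M ?F = K' \<and> Kminus M ?F = K"
    using face(3) two'[OF face(1)] two'[OF face(2)] by metis
  note pm = this
  show ?thesis
  proof (rule that[of K'])
    show "face_at M x \<in> interior_faces M" using F by (simp only: F_at)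
    show "x \<in> face_at M x" using x(1) K'(3) by (simp only: F_at Int_iff)
    show "F = face_at M x" if "F \<in> interior_faces M" "x \<in> F" for F
      using unique[OF that] by (simp only: F_at)
    show "Kplus M (face_at M x) = K \<and> Kminus M (face_at M x) = K' \<or>
        Kplus M (face_at M x) = K' \<and> Kminus M (face_at M x) = K"
      using pm by (simp only: F_at)
  qed (fact K' two')+
qed


section \<open>The boundary terms\<close>

lemma frontier_Int_open_iff:
  assumes "closed K" "open U" "x \<notin> frontier U"
  shows "x \<in> frontier (K \<inter> U) \<longleftrightarrow> x \<in> U \<and> x \<in> frontier K"
proof
  assume x: "x \<in> frontier (K \<inter> U)"
  then have "x \<in> closure U"
    using closure_mono[of "K \<inter> U" U] by (auto simp: frontier_def)
  then have "x \<in> U" using assms(2,3) by (auto simp: frontier_def interior_open)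
  moreover have "x \<in> frontier K"
    using x assms(3) by (auto simp: frontier_Int)
  ultimately show "x \<in> U \<and> x \<in> frontier K" ..
next
  assume x: "x \<in> U \<and> x \<in> frontier K"
  then have "x \<in> K \<inter> U" using frontier_subset_closed[OF assms(1)] by blast
  with x show "x \<in> frontier (K \<inter> U)"
    using closure_subset[of "K \<inter> U"] by (auto simp: frontier_Int)
qed

text \<open>Away from the boundary of the domain, the function agrees with a finite sum of Borel functions, one
  for each face, supported on the points of the face at which \<open>K\<close> has a normal. At the other points,
  such as the edges of \<open>K\<close>, where \<open>face_at\<close> may be unspecified, the normal is zero.\<close>

lemma set_integrable_facewise:
  fixes M :: "'a::euclidean_space cut_mesh"
  assumes M: "valid_cut_mesh M"
    and hausdorff: "\<forall>A\<in>sets (borel :: 'a measure). emeasure surface_measure A = hausdorff_outer (DIM('a) - 1) A"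
    and K: "K \<in> active_mesh M"
    and b: "bounded_borel b" and g: "\<And>F. F \<in> interior_faces M \<Longrightarrow> bounded_borel (g F)"
  shows "set_integrable surface_measure (frontier (K \<inter> domain M))
    (\<lambda>x. (if x \<in> frontier (domain M) then b x else g (face_at M x) x) \<bullet> outward_normal (K \<inter> domain M) x)"
proof -
  let ?\<Omega> = "domain M" and ?S = "frontier (K \<inter> domain M)"
  let ?n = "outward_normal (K \<inter> ?\<Omega>)"
  have \<Omega>: "open ?\<Omega>" "bounded ?\<Omega>" "emeasure surface_measure (frontier ?\<Omega>) < \<infinity>"
    using M by (auto simp: valid_cut_mesh_def bounded_domain_def)
  have cell: "closed K" "bounded K" "emeasure surface_measure (frontier K) < \<infinity>"
    using cell_of_mesh[OF M active_mesh_bg[OF K]] by auto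
  have S_sub: "?S \<subseteq> frontier K \<union> frontier ?\<Omega>"
    by (auto simp: frontier_Int)
  have S: "?S \<in> sets borel" "bounded ?S"
    using cell(2) by (auto intro!: borel_closed bounded_subset[OF bounded_closure[of "K \<inter> ?\<Omega>"]]
        bounded_Int simp: frontier_def)
  have "emeasure surface_measure ?S \<le> emeasure surface_measure (frontier K \<union> frontier ?\<Omega>)"
    using S_sub by (intro emeasure_mono) (auto intro!: borel_closed)
  also have "\<dots> \<le> emeasure surface_measure (frontier K) + emeasure surface_measure (frontier ?\<Omega>)"
    by (intro emeasure_subadditive) (auto intro!: borel_closed)
  also have "\<dots> < \<infinity>" using cell(3) \<Omega>(3) by simp
  finally have S_fin: "emeasure surface_measure ?S < \<infinity>" .
  define A where "A F = {x \<in> F \<inter> frontier K \<inter> ?\<Omega>. ?n x \<noteq> 0}" for F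
  have A: "A F \<in> sets borel" if "F \<in> interior_faces M" for F
  proof -
    have "closed F" using that by (auto simp: interior_faces_def)
    then have "F \<inter> frontier K \<inter> ?\<Omega> \<in> sets borel"
      using \<Omega>(1) by (auto intro!: borel_closed borel_open)
    moreover have "{x. ?n x \<noteq> 0} \<in> sets borel"
      using borel_measurable_outward_normal[of "K \<inter> ?\<Omega>"] by measurable
    ultimately have "(F \<inter> frontier K \<inter> ?\<Omega>) \<inter> {x. ?n x \<noteq> 0} \<in> sets borel" by (rule sets.Int)
    then show ?thesis by (simp add: A_def Int_def conj_ac)
  qed
  have "set_integrable surface_measure ?S (\<lambda>x. indicator (frontier ?\<Omega>) x * (b x \<bullet> ?n x) +
      (\<Sum>F\<in>interior_faces M. indicator (A F) x * (g F x \<bullet> ?n x)))"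
  proof (rule set_integral_add(1))
    show "set_integrable surface_measure ?S (\<lambda>x. indicator (frontier ?\<Omega>) x * (b x \<bullet> ?n x))"
      using S S_fin b
      by (intro set_integrable_bounded_borel bounded_borel_intros bounded_borel_indicator) auto
    have "set_integrable surface_measure ?S (\<lambda>x. indicator (A F) x * (g F x \<bullet> ?n x))"
      if "F \<in> interior_faces M" for F
      using S S_fin A g that
      by (intro set_integrable_bounded_borel bounded_borel_intros bounded_borel_indicator) auto
    then show "set_integrable surface_measure ?S
        (\<lambda>x. \<Sum>F\<in>interior_faces M. indicator (A F) x * (g F x \<bullet> ?n x))"
      unfolding set_integrable_def scaleR_sum_right by (intro Bochner_Integration.integrable_sum)
  qed
  moreover have "indicator (frontier ?\<Omega>) x * (b x \<bullet> ?n x) +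
      (\<Sum>F\<in>interior_faces M. indicator (A F) x * (g F x \<bullet> ?n x)) =
      (if x \<in> frontier ?\<Omega> then b x else g (face_at M x) x) \<bullet> ?n x" (is "?l = ?r") if x: "x \<in> ?S" for x
  proof (cases "x \<in> frontier ?\<Omega>")
    case True
    then have "x \<notin> A F" for F using \<Omega>(1) by (auto simp: A_def frontier_def interior_open)
    with True show ?thesis by simp
  next
    case False
    then have x\<Omega>: "x \<in> ?\<Omega>" and xK: "x \<in> frontier K"
      using x frontier_Int_open_iff[OF cell(1) \<Omega>(1)] by auto
    have n: "?n x = outward_normal K x" by (rule outward_normal_Int_open[OF \<Omega>(1) x\<Omega>])
    show ?thesis
    proof (cases "?n x = 0")
      case True
      then show ?thesis by simp
    next
      case nz: False
      obtain F: "face_at M x \<in> interior_faces M" "x \<in> face_at M x"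
        and unique: "\<And>F. F \<in> interior_faces M \<Longrightarrow> x \<in> F \<Longrightarrow> F = face_at M x"
        by (rule face_at_neighbours[OF M hausdorff K xK x\<Omega> nz[unfolded n]]) (rule that)
      have "indicator (A F) x * (g F x \<bullet> ?n x) = (if F = face_at M x then g F x \<bullet> ?n x else 0)"
        if "F \<in> interior_faces M" for F
      proof (cases "F = face_at M x")
        case True
        then show ?thesis using F(2) xK x\<Omega> nz by (simp add: A_def)
      next
        case False
        then have "x \<notin> F" using unique[OF that] by blast
        with False show ?thesis by (simp add: A_def)
      qed
      then have "(\<Sum>F\<in>interior_faces M. indicator (A F) x * (g F x \<bullet> ?n x)) = g (face_at M x) x \<bullet> ?n x"
        using F(1) finite_interior_faces[OF M] by (simp add: sum.delta' cong: sum.cong)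
      with False show ?thesis by simp
    qed
  qed
  ultimately show ?thesis
    by (subst set_integrable_cong[OF refl refl, symmetric]) auto
qed

text \<open>The contributions of the two cells that share a face, with outward normals \<open>n\<close> and \<open>- n\<close>. Because
  the two averages have complementary weights, only the penalised jumps remain.\<close>

lemma flux_terms_cancel:
  fixes gp gq n :: "'a::euclidean_space" and vp vq \<alpha> \<beta> \<tau> :: real
  assumes "norm n = 1" and vh: "vh = \<alpha> * vp + (1 - \<alpha>) * vq - \<tau> * (gp \<bullet> n + gq \<bullet> (- n))"
    and gh: "gh = (1 - \<alpha>) *\<^sub>R gp + \<alpha> *\<^sub>R gq - \<beta> *\<^sub>R (vp *\<^sub>R n + vq *\<^sub>R (- n))"
  shows "((vh - vp) * (gp \<bullet> n) + vp * (gh \<bullet> n)) + ((vh - vq) * (gq \<bullet> (- n)) + vq * (gh \<bullet> (- n))) =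
    - \<tau> * (gp \<bullet> n - gq \<bullet> n)\<^sup>2 - \<beta> * (vp - vq)\<^sup>2"
proof -
  have "n \<bullet> n = 1" using assms(1) by (simp add: norm_eq_1)
  then have gh_n: "gh \<bullet> n = (1 - \<alpha>) * (gp \<bullet> n) + \<alpha> * (gq \<bullet> n) - \<beta> * (vp - vq)"
    by (simp add: gh inner_diff_left inner_add_left)
  show ?thesis
    unfolding inner_minus_right gh_n vh by (simp add: power2_eq_square algebra_simps)
qed

text \<open>If the surface measure is not zero, the integrands of both sums are added before integrating. Their sum over all cells is zero on the
  boundary of the domain and at the points without normal, and it is the dissipation of
  \<open>flux_terms_cancel\<close> at the points where two cells meet.\<close>

lemma boundary_terms_nonpos:
  fixes M :: "'a::euclidean_space cut_mesh"
  assumes M: "valid_cut_mesh M" and u: "u \<in> broken_space M k p" and v: "v \<in> broken_space M k q"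
    and "0 \<le> \<tau>" "0 \<le> \<beta>"
  shows "(\<Sum>K\<in>active_mesh M. LINT x:frontier (K \<inter> domain M)|surface_measure.
      (flux_v M \<alpha> \<tau> u v x - v K x) * (grad (u K) x \<bullet> outward_normal (K \<inter> domain M) x)) +
    (\<Sum>K\<in>active_mesh M. LINT x:frontier (K \<inter> domain M)|surface_measure.
      v K x * (flux_grad_u M \<alpha> \<beta> u v K x \<bullet> outward_normal (K \<inter> domain M) x)) \<le> 0"
proof (cases rule: surface_measure_cases[where 'a = 'a])
  case null
  have "AE x in surface_measure. P x" for P :: "'a \<Rightarrow> bool"
    by (rule AE_I[where N = UNIV]) (use null in auto)
  then have "(LINT x:S|surface_measure. f x) = 0" for S and f :: "'a \<Rightarrow> real"
    unfolding set_lebesgue_integral_def by (rule integral_eq_zero_AE)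
  then show ?thesis by simp
next
  case hausdorff
  let ?\<Omega> = "domain M"
  have \<Omega>: "open ?\<Omega>" using M by (auto simp: valid_cut_mesh_def bounded_domain_def)
  define n where "n K = outward_normal (K \<inter> ?\<Omega>)" for K
  \<comment> \<open>the fluxes as functions of the face instead of the point alone\<close>
  define vF where "vF F x = \<alpha> * v (Kplus M F) x + (1 - \<alpha>) * v (Kminus M F) x
      - \<tau> * vector_jump M F (\<lambda>K. grad (u K)) x" for F x
  define gF where "gF F x = (1 - \<alpha>) *\<^sub>R grad (u (Kplus M F)) x + \<alpha> *\<^sub>R grad (u (Kminus M F)) x
      - \<beta> *\<^sub>R jump M F v x" for F x
  define f where "f K x = (flux_v M \<alpha> \<tau> u v x - v K x) * (grad (u K) x \<bullet> n K x)" for K x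
  define h where "h K x = v K x * (flux_grad_u M \<alpha> \<beta> u v K x \<bullet> n K x)" for K x
  have poly: "u K \<in> poly_space k p" "v K \<in> poly_space k q" if "K \<in> active_mesh M" for K
    using u v that by (auto simp: broken_space_def)
  have cont: "continuous_on UNIV (v K)" "continuous_on UNIV (grad (u K))" if "K \<in> active_mesh M" for K
    using poly[OF that] by (auto intro: continuous_on_poly_space GDERIV_grad_poly(2))
  have cont': "bounded_borel (v K)" "bounded_borel (grad (u K))" if "K \<in> active_mesh M" for K
    using cont[OF that] by (auto intro: bounded_borel_continuous)
  have faces: "Kplus M F \<in> active_mesh M" "Kminus M F \<in> active_mesh M" if "F \<in> interior_faces M" for F
    using valid_cut_mesh_face[OF M that] by simp_all
  have bb: "bounded_borel (vF F)" "bounded_borel (gF F)" if "F \<in> interior_faces M" for F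
    unfolding vF_def gF_def vector_jump_def jump_def
    by (intro bounded_borel_intros cont' faces that)+
  have f_eq: "f K x = (if x \<in> frontier ?\<Omega> then (- v K x) *\<^sub>R grad (u K) x
      else (vF (face_at M x) x - v K x) *\<^sub>R grad (u K) x) \<bullet> n K x" for K x
    by (simp add: f_def flux_v_def vF_def Let_def)
  have h_eq: "h K x = (if x \<in> frontier ?\<Omega> then v K x *\<^sub>R grad (u K) x
      else v K x *\<^sub>R gF (face_at M x) x) \<bullet> n K x" for K x
    by (simp add: h_def flux_grad_u_def gF_def Let_def)
  have f_int: "set_integrable surface_measure (frontier (K \<inter> ?\<Omega>)) (f K)" if K: "K \<in> active_mesh M" for K
  proof -
    have "bounded_borel (\<lambda>x. (0 - v K x) *\<^sub>R grad (u K) x)"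
      by (intro bounded_borel_intros cont' K)
    then have "bounded_borel (\<lambda>x. (- v K x) *\<^sub>R grad (u K) x)" by simp
    moreover have "bounded_borel (\<lambda>x. (vF F x - v K x) *\<^sub>R grad (u K) x)" if "F \<in> interior_faces M" for F
      by (intro bounded_borel_intros cont' K bb that)
    ultimately show ?thesis
      unfolding f_eq[abs_def] n_def
      by (rule set_integrable_facewise[OF M hausdorff K, where g = "\<lambda>F x. (vF F x - v K x) *\<^sub>R grad (u K) x"])
  qed
  have h_int: "set_integrable surface_measure (frontier (K \<inter> ?\<Omega>)) (h K)" if K: "K \<in> active_mesh M" for K
  proof -
    have "bounded_borel (\<lambda>x. v K x *\<^sub>R grad (u K) x)"
      by (intro bounded_borel_intros cont' K)
    moreover have "bounded_borel (\<lambda>x. v K x *\<^sub>R gF F x)" if "F \<in> interior_faces M" for F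
      by (intro bounded_borel_intros cont' K bb that)
    ultimately show ?thesis
      unfolding h_eq[abs_def] n_def
      by (rule set_integrable_facewise[OF M hausdorff K, where g = "\<lambda>F x. v K x *\<^sub>R gF F x"])
  qed
  have restrict: "indicator (frontier (K \<inter> ?\<Omega>)) x * (f K x + h K x) =
      (if x \<in> ?\<Omega> \<and> x \<in> frontier K then f K x + h K x else 0)" if K: "K \<in> active_mesh M" for K x
  proof (cases "x \<in> frontier ?\<Omega>")
    case True
    then have "x \<notin> ?\<Omega>" using \<Omega> by (auto simp: frontier_def interior_open)
    moreover have "f K x + h K x = 0" using True by (simp add: f_eq h_eq)
    ultimately show ?thesis by simp
  next
    case False
    have "closed K" using cell_of_mesh[OF M active_mesh_bg[OF K]] by simp
    from frontier_Int_open_iff[OF this \<Omega> False] show ?thesis by simp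
  qed
  have dissipation: "- \<tau> * a\<^sup>2 - \<beta> * b\<^sup>2 \<le> 0" for a b :: real
    using mult_nonneg_nonneg[OF \<open>0 \<le> \<tau>\<close> zero_le_power2[of a]]
      mult_nonneg_nonneg[OF \<open>0 \<le> \<beta>\<close> zero_le_power2[of b]] by simp
  have nonpos: "(\<Sum>K\<in>active_mesh M. indicator (frontier (K \<inter> ?\<Omega>)) x * (f K x + h K x)) \<le> 0" for x
  proof (cases "x \<in> ?\<Omega> \<and> (\<exists>K\<in>active_mesh M. x \<in> frontier K \<and> n K x \<noteq> 0)")
    case False
    have "(\<Sum>K\<in>active_mesh M. indicator (frontier (K \<inter> ?\<Omega>)) x * (f K x + h K x)) = 0"
    proof (intro sum.neutral ballI)
      fix L assume L: "L \<in> active_mesh M"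
      then have "n L x = 0" if "x \<in> ?\<Omega> \<and> x \<in> frontier L" using False that by blast
      then show "indicator (frontier (L \<inter> ?\<Omega>)) x * (f L x + h L x) = 0"
        unfolding restrict[OF L] by (simp add: f_def h_def)
    qed
    then show ?thesis by simp
  next
    case True
    then obtain K where x: "x \<in> ?\<Omega>" and K: "K \<in> active_mesh M" "x \<in> frontier K" "n K x \<noteq> 0" by blast
    have n: "n L x = outward_normal L x" for L
      unfolding n_def by (rule outward_normal_Int_open[OF \<Omega> x])
    let ?F = "face_at M x"
    obtain K' where K': "K' \<in> active_mesh M" "K' \<noteq> K" "x \<in> frontier K'"
      and nK: "norm (outward_normal K x) = 1" "outward_normal K' x = - outward_normal K x"
      and two: "\<And>L. L \<in> active_mesh M \<Longrightarrow> x \<in> frontier L \<Longrightarrow> L = K \<or> L = K'"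
      and pm: "Kplus M ?F = K \<and> Kminus M ?F = K' \<or> Kplus M ?F = K' \<and> Kminus M ?F = K"
      by (rule face_at_neighbours[OF M hausdorff K(1,2) x K(3)[unfolded n]]) (rule that)
    let ?p = "Kplus M ?F" and ?q = "Kminus M ?F"
    have pq: "{?p, ?q} = {K, K'}" "?p \<noteq> ?q" using pm K'(2) by auto
    have np: "norm (outward_normal ?p x) = 1" "outward_normal ?q x = - outward_normal ?p x"
      using pm nK by auto
    have x_frontier: "x \<notin> frontier ?\<Omega>" using x \<Omega> by (auto simp: frontier_def interior_open)
    have fin: "finite (active_mesh M)" by (rule finite_active_mesh[OF M])
    have "(\<Sum>L\<in>active_mesh M. indicator (frontier (L \<inter> ?\<Omega>)) x * (f L x + h L x)) =
        (\<Sum>L\<in>active_mesh M. if x \<in> ?\<Omega> \<and> x \<in> frontier L then f L x + h L x else 0)"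
      by (intro sum.cong refl restrict)
    also have "\<dots> = (\<Sum>L\<in>{K, K'}. f L x + h L x)"
      using fin K K' x two by (intro sum.mono_neutral_cong_right) auto
    also have "\<dots> = (f ?p x + h ?p x) + (f ?q x + h ?q x)"
      using pq(2) by (simp flip: pq(1))
    also have "\<dots> = - \<tau> * (grad (u ?p) x \<bullet> outward_normal ?p x - grad (u ?q) x \<bullet> outward_normal ?p x)\<^sup>2
        - \<beta> * (v ?p x - v ?q x)\<^sup>2"
      using flux_terms_cancel[OF np(1), of "vF ?F x" \<alpha> "v ?p x" "v ?q x" \<tau> "grad (u ?p) x" "grad (u ?q) x"
          "gF ?F x" \<beta>]
      using x_frontier by (simp add: f_eq h_eq n np(2) vF_def gF_def vector_jump_def jump_def)
    also have "\<dots> \<le> 0"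
      by (rule dissipation)
    finally show ?thesis .
  qed
  have int: "integrable surface_measure (\<lambda>x. indicator (frontier (K \<inter> ?\<Omega>)) x * (f K x + h K x))"
    if "K \<in> active_mesh M" for K
    using set_integral_add(1)[OF f_int[OF that] h_int[OF that]] by (simp add: set_integrable_def)
  have "(\<Sum>K\<in>active_mesh M. LINT x:frontier (K \<inter> ?\<Omega>)|surface_measure. f K x) +
      (\<Sum>K\<in>active_mesh M. LINT x:frontier (K \<inter> ?\<Omega>)|surface_measure. h K x) =
      (\<Sum>K\<in>active_mesh M. LINT x:frontier (K \<inter> ?\<Omega>)|surface_measure. f K x + h K x)"
    unfolding sum.distrib[symmetric] by (intro sum.cong refl set_integral_add(2)[symmetric] f_int h_int)
  also have "\<dots> = (LINT x|surface_measure.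
      (\<Sum>K\<in>active_mesh M. indicator (frontier (K \<inter> ?\<Omega>)) x * (f K x + h K x)))"
    unfolding set_lebesgue_integral_def using int
    by (subst Bochner_Integration.integral_sum) simp_all
  also have "\<dots> \<le> (LINT x|(surface_measure :: 'a measure). 0)"
    using nonpos int by (intro integral_mono Bochner_Integration.integrable_sum) simp_all
  finally show ?thesis by (simp add: f_def h_def n_def)
qed


section \<open>Energy decay\<close>

text \<open>On each face the jump of the \<open>l\<close>-th normal derivative depends linearly on the nodal values in the two
  adjacent cells.\<close>

lemma has_real_derivative_ghost_penalty:
  fixes w :: "real \<Rightarrow> 'a::euclidean_space broken"
  assumes M: "valid_cut_mesh M"
    and U: "open U" "t \<in> U" and space: "\<And>s. s \<in> U \<Longrightarrow> w s \<in> broken_space M k r"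
    and diff: "\<And>K x. K \<in> active_mesh M \<Longrightarrow> (\<lambda>s. w s K x) differentiable (at t)"
  shows "((\<lambda>s. ghost_penalty M \<omega> m (w s) (w s)) has_real_derivative
    2 * ghost_penalty M \<omega> m (time_deriv w t) (w t)) (at t)"
proof -
  let ?A = "\<lambda>F l z. jump M F (\<lambda>K. dir_deriv l (face_normal M F) (z K))"
  obtain X :: "'a set" and L where XL: "finite X" "\<And>y. y \<in> X \<Longrightarrow> L y \<in> poly_space k r"
    "\<And>f. f \<in> poly_space k r \<Longrightarrow> f = (\<lambda>z. \<Sum>y\<in>X. f y * L y z)"
    by (rule poly_space_interpolation[of k r]) (rule that)
  have deriv: "((\<lambda>s. LINT x:F|surface_measure. ?A F l (w s) x \<bullet> ?A F l (w s) x) has_real_derivative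
      2 * (LINT x:F|surface_measure. ?A F l (time_deriv w t) x \<bullet> ?A F l (w t) x)) (at t)"
    if F: "F \<in> interior_faces M" for F l
  proof -
    note face = valid_cut_mesh_face[OF M F]
    let ?N = "face_normal M F" and ?\<K> = "{Kplus M F, Kminus M F}"
    let ?G = "\<lambda>K y x. dir_deriv l ?N (L y) x *\<^sub>R outward_normal K x"
    have "frontier (Kplus M F) \<inter> frontier (Kminus M F) \<subseteq> frontier (Kplus M F)" by blast
    then have sub: "F \<subseteq> frontier (Kplus M F)" by (subst face(4))
    note cell = cell_of_mesh[OF M active_mesh_bg[OF face(1)]]
    have "closed (frontier (Kplus M F) \<inter> frontier (Kminus M F))" by auto
    then have "closed F" by (subst face(4))
    have "bounded F"
      using sub frontier_subset_closed[OF cell(1)] cell(2) by (blast intro: bounded_subset)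
    have "emeasure surface_measure F \<le> emeasure surface_measure (frontier (Kplus M F))"
      using sub by (intro emeasure_mono) auto
    then have fin: "emeasure surface_measure F < \<infinity>"
      using cell(3) by (rule order.strict_trans1)
    have trace: "dir_deriv l ?N (z K) x = (\<Sum>y\<in>X. z K y * dir_deriv l ?N (L y) x)"
      if "z \<in> broken_space M k r" "K \<in> active_mesh M" for z K x
    proof -
      have "z K = (\<lambda>x. \<Sum>y\<in>X. z K y * L y x)"
        using that by (intro XL(3)) (simp add: broken_space_def)
      then have "dir_deriv l ?N (z K) x = dir_deriv l ?N (\<lambda>x. \<Sum>y\<in>X. z K y * L y x) x"
        by (rule arg_cong)
      also have "\<dots> = (\<Sum>y\<in>X. z K y * dir_deriv l ?N (L y) x)"
        by (rule dir_deriv_linear_combination[OF XL(2)])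
      finally show ?thesis .
    qed
    show ?thesis
    proof (rule has_real_derivative_quadratic_trajectory[where \<K> = ?\<K> and X = X and G = ?G, OF U space diff])
      show "?\<K> \<subseteq> active_mesh M" using face by simp
      show "?A F l z x = (\<Sum>(K, y)\<in>?\<K> \<times> X. z K y *\<^sub>R ?G K y x)" if "z \<in> broken_space M k r" for z x
        using face(1-3) by (simp add: jump_def trace[OF that] scaleR_sum_left
            flip: sum.cartesian_product)
      show "set_integrable surface_measure F (\<lambda>x. ?G K y x \<bullet> ?G K' y' x)" if "y \<in> X" "y' \<in> X" for K K' y y'
        using \<open>closed F\<close> \<open>bounded F\<close> fin
        by (intro set_integrable_bounded_borel bounded_borel_intros bounded_borel_continuous
            continuous_on_dir_deriv[OF XL(2)] that) auto
    qed
  qed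
  show ?thesis
  proof (rule DERIV_cong)
    show "((\<lambda>s. ghost_penalty M \<omega> m (w s) (w s)) has_real_derivative
        (\<Sum>F\<in>ghost_faces M. \<Sum>l\<le>m. \<omega> l * mesh_size M ^ (2 * l + 1) / (real (2 * l + 1) * (fact l)\<^sup>2) *
          (2 * (LINT x:F|surface_measure. ?A F l (time_deriv w t) x \<bullet> ?A F l (w t) x)))) (at t)"
      unfolding ghost_penalty_def
      by (intro DERIV_sum DERIV_cmult deriv) (simp add: ghost_faces_def)
    show "(\<Sum>F\<in>ghost_faces M. \<Sum>l\<le>m. \<omega> l * mesh_size M ^ (2 * l + 1) / (real (2 * l + 1) * (fact l)\<^sup>2) *
          (2 * (LINT x:F|surface_measure. ?A F l (time_deriv w t) x \<bullet> ?A F l (w t) x))) =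
        2 * ghost_penalty M \<omega> m (time_deriv w t) (w t)"
      unfolding ghost_penalty_def sum_distrib_left by (intro sum.cong refl) simp
  qed
qed

lemma cell_domain_borel:
  assumes "valid_cut_mesh M" "K \<in> active_mesh M"
  shows "K \<inter> domain M \<in> sets borel" "bounded (K \<inter> domain M)"
  using cell_of_mesh[OF assms(1) active_mesh_bg[OF assms(2)]] assms(1)
  by (auto simp: valid_cut_mesh_def bounded_domain_def bounded_Int intro!: sets.Int borel_closed borel_open)

lemma has_real_derivative_discrete_energy:
  fixes u v :: "real \<Rightarrow> 'a::euclidean_space broken"
  assumes M: "valid_cut_mesh M" and U: "open U" "t \<in> U"
    and u: "\<And>s. s \<in> U \<Longrightarrow> u s \<in> broken_space M k p"
      "\<And>K x. K \<in> active_mesh M \<Longrightarrow> (\<lambda>s. u s K x) differentiable (at t)"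
    and v: "\<And>s. s \<in> U \<Longrightarrow> v s \<in> broken_space M k q"
      "\<And>K x. K \<in> active_mesh M \<Longrightarrow> (\<lambda>s. v s K x) differentiable (at t)"
  shows "((\<lambda>s. discrete_energy M (u s) (v s)) has_real_derivative
    (\<Sum>K\<in>active_mesh M. (LINT x:K \<inter> domain M|lborel. grad (time_deriv u t K) x \<bullet> grad (u t K) x) +
      (LINT x:K \<inter> domain M|lborel. time_deriv v t K x * v t K x))) (at t)"
proof (rule has_field_derivative_transform_within_open[OF _ U])
  let ?S = "\<lambda>K. K \<inter> domain M"
  have half: "1 / 2 * (\<Sum>K\<in>\<K>. 2 * a K + 2 * b K) = (\<Sum>K\<in>\<K>. a K + b K)"
    for a b :: "'a set \<Rightarrow> real" and \<K>
    unfolding sum_distrib_left by (intro sum.cong refl) (simp add: distrib_left)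
  have "((\<lambda>s. 1 / 2 * (\<Sum>K\<in>active_mesh M. (LINT x:?S K|lborel. (norm (grad (u s K) x))\<^sup>2) +
      (LINT x:?S K|lborel. (v s K x)\<^sup>2))) has_real_derivative
    1 / 2 * (\<Sum>K\<in>active_mesh M. 2 * (LINT x:?S K|lborel. grad (time_deriv u t K) x \<bullet> grad (u t K) x) +
      2 * (LINT x:?S K|lborel. time_deriv v t K x * v t K x))) (at t)"
    by (intro DERIV_cmult DERIV_sum DERIV_add has_real_derivative_cell_integrals(1)[OF U u]
        has_real_derivative_cell_integrals(2)[OF U v] cell_domain_borel[OF M])
  then show "((\<lambda>s. 1 / 2 * (\<Sum>K\<in>active_mesh M. (LINT x:?S K|lborel. (norm (grad (u s K) x))\<^sup>2) +
      (LINT x:?S K|lborel. (v s K x)\<^sup>2))) has_real_derivative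
    (\<Sum>K\<in>active_mesh M. (LINT x:?S K|lborel. grad (time_deriv u t K) x \<bullet> grad (u t K) x) +
      (LINT x:?S K|lborel. time_deriv v t K x * v t K x))) (at t)"
    unfolding half .
  fix s assume s: "s \<in> U"
  show "1 / 2 * (\<Sum>K\<in>active_mesh M. (LINT x:?S K|lborel. (norm (grad (u s K) x))\<^sup>2) +
      (LINT x:?S K|lborel. (v s K x)\<^sup>2)) = discrete_energy M (u s) (v s)"
    unfolding discrete_energy_def
  proof (intro arg_cong[of _ _ "\<lambda>z. 1 / 2 * z"] sum.cong refl set_integral_add(2)[symmetric])
    fix K assume K: "K \<in> active_mesh M"
    have "u s K \<in> poly_space k p" "v s K \<in> poly_space k q"
      using u(1)[OF s] v(1)[OF s] K by (auto simp: broken_space_def)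
    note cont = GDERIV_grad_poly(2)[OF this(1)] continuous_on_poly_space[OF this(2)]
    show "set_integrable lborel (?S K) (\<lambda>x. (norm (grad (u s K) x))\<^sup>2)"
      by (intro set_integrable_continuous_bounded cell_domain_borel[OF M K] continuous_on_power
          continuous_on_norm cont)
    show "set_integrable lborel (?S K) (\<lambda>x. (v s K x)\<^sup>2)"
      by (intro set_integrable_continuous_bounded cell_domain_borel[OF M K] continuous_on_power cont)
  qed
qed

theorem theorem3p1:
  fixes M :: "'a::euclidean_space cut_mesh"
    and k :: poly_kind and p q :: nat
    and \<omega> :: "nat \<Rightarrow> real" and \<alpha> \<tau> \<beta> \<gamma>u \<gamma>v T t :: real
    and u v :: "real \<Rightarrow> 'a broken"
  assumes "valid_cut_mesh M"
    and "\<And>l. \<omega> l > 0" and "\<gamma>u > 0" and "\<gamma>v > 0"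
    and "\<tau> \<ge> 0" and "\<beta> \<ge> 0"
    and "cutedg_solution M k p q \<omega> \<alpha> \<tau> \<beta> \<gamma>u \<gamma>v (\<lambda>t x. 0) T u v"
    and "t \<in> {0<..<T}"
  shows "\<exists>D. ((\<lambda>s. discrete_energy M (u s) (v s)
                  + 1 / 2 * (\<gamma>u / (mesh_size M)\<^sup>2) * ghost_penalty M \<omega> p (u s) (u s)
                  + 1 / 2 * \<gamma>v * ghost_penalty M \<omega> q (v s) (v s))
               has_real_derivative D) (at t) \<and> D \<le> 0"
proof -
  note M = assms(1) and sol = assms(7)[unfolded cutedg_solution_def, rule_format]
  let ?U = "{0<..<T}" and ?S = "\<lambda>K. K \<inter> domain M"
  define ut where "ut = time_deriv u t"
  define vt where "vt = time_deriv v t"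
  have U: "open ?U" "t \<in> ?U" using assms(8) by auto
  have u: "u s \<in> broken_space M k p" and v: "v s \<in> broken_space M k q" if "s \<in> ?U" for s
    using sol[OF that] by blast+
  have du: "(\<lambda>s. u s K x) differentiable (at t)" and dv: "(\<lambda>s. v s K x) differentiable (at t)"
    if "K \<in> active_mesh M" for K x
    using sol[OF U(2)] that by blast+
  have ut: "ut \<in> broken_space M k p"
    unfolding ut_def by (rule time_deriv_broken_space[OF U u du])
  have vt: "vt \<in> broken_space M k q"
    unfolding vt_def by (rule time_deriv_broken_space[OF U v dv])
  have zero: "((\<lambda>K x. 0) :: 'a broken) \<in> broken_space M k 0"
    using poly_space_sum[of "{}" "\<lambda>_. undefined :: 'a \<Rightarrow> real" k 0] by (simp add: broken_space_def)
  have scheme: "\<forall>\<phi>u\<in>broken_space M k p. \<forall>\<phi>v\<in>broken_space M k q. \<forall>\<phi>c\<in>broken_space M k 0.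
      cutedg_eq_u M p \<omega> \<alpha> \<tau> \<gamma>u (u t) (v t) ut \<phi>u \<and>
      cutedg_eq_v M q \<omega> \<alpha> \<beta> \<gamma>v (\<lambda>x. 0) (u t) (v t) vt \<phi>v \<and>
      cutedg_eq_const M p \<omega> \<gamma>u (v t) ut \<phi>c"
    using sol[OF U(2)] unfolding ut_def vt_def by (elim conjE)
  note tested = bspec[OF bspec[OF bspec[OF scheme u[OF U(2)]] v[OF U(2)]] zero]
  have eq_u: "cutedg_eq_u M p \<omega> \<alpha> \<tau> \<gamma>u (u t) (v t) ut (u t)"
    and eq_v: "cutedg_eq_v M q \<omega> \<alpha> \<beta> \<gamma>v (\<lambda>x. 0) (u t) (v t) vt (v t)"
    using tested by simp_all
  define E where "E = (\<Sum>K\<in>active_mesh M. (LINT x:?S K|lborel. grad (ut K) x \<bullet> grad (u t K) x) +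
      (LINT x:?S K|lborel. vt K x * v t K x))"
  define D where "D = E + \<gamma>u / (mesh_size M)\<^sup>2 * ghost_penalty M \<omega> p ut (u t)
      + \<gamma>v * ghost_penalty M \<omega> q vt (v t)"
  have "((\<lambda>s. discrete_energy M (u s) (v s)
      + 1 / 2 * (\<gamma>u / (mesh_size M)\<^sup>2) * ghost_penalty M \<omega> p (u s) (u s)
      + 1 / 2 * \<gamma>v * ghost_penalty M \<omega> q (v s) (v s)) has_real_derivative
      (E + 1 / 2 * (\<gamma>u / (mesh_size M)\<^sup>2) * (2 * ghost_penalty M \<omega> p ut (u t))
      + 1 / 2 * \<gamma>v * (2 * ghost_penalty M \<omega> q vt (v t)))) (at t)"
    unfolding E_def ut_def vt_def
    by (intro DERIV_add DERIV_cmult has_real_derivative_discrete_energy[OF M U u du v dv]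
        has_real_derivative_ghost_penalty[OF M U u du] has_real_derivative_ghost_penalty[OF M U v dv])
  moreover have "E + 1 / 2 * (\<gamma>u / (mesh_size M)\<^sup>2) * (2 * ghost_penalty M \<omega> p ut (u t))
      + 1 / 2 * \<gamma>v * (2 * ghost_penalty M \<omega> q vt (v t)) = D"
    by (simp add: D_def)
  moreover have "D \<le> 0"
  proof -
    \<comment> \<open>the mixed terms \<open>\<nabla>u \<bullet> \<nabla>v\<close> of the two equations cancel\<close>
    have cell: "(LINT x:?S K|lborel. grad (u t K) x \<bullet> grad (\<lambda>y. ut K y - v t K y) x) +
        (LINT x:?S K|lborel. v t K x * vt K x + grad (v t K) x \<bullet> grad (u t K) x) =
        (LINT x:?S K|lborel. grad (ut K) x \<bullet> grad (u t K) x) + (LINT x:?S K|lborel. vt K x * v t K x)"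
      if K: "K \<in> active_mesh M" for K
    proof -
      have poly: "u t K \<in> poly_space k p" "ut K \<in> poly_space k p" "v t K \<in> poly_space k q" "vt K \<in> poly_space k q"
        using u[OF U(2)] v[OF U(2)] ut vt K by (auto simp: broken_space_def)
      note int = set_integrable_continuous_bounded[OF cell_domain_borel[OF M K]]
      have int1: "set_integrable lborel (?S K) (\<lambda>x. grad (u t K) x \<bullet> grad (ut K) x)"
        and int2: "set_integrable lborel (?S K) (\<lambda>x. grad (u t K) x \<bullet> grad (v t K) x)"
        and int3: "set_integrable lborel (?S K) (\<lambda>x. v t K x * vt K x)"
        by (intro int continuous_on_inner continuous_on_mult GDERIV_grad_poly(2)[OF poly(1)]
            GDERIV_grad_poly(2)[OF poly(2)] GDERIV_grad_poly(2)[OF poly(3)]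
            continuous_on_poly_space[OF poly(3)] continuous_on_poly_space[OF poly(4)])+
      have "(LINT x:?S K|lborel. grad (u t K) x \<bullet> grad (\<lambda>y. ut K y - v t K y) x) =
          (LINT x:?S K|lborel. grad (u t K) x \<bullet> grad (ut K) x) - (LINT x:?S K|lborel. grad (u t K) x \<bullet> grad (v t K) x)"
        by (simp add: grad_diff_poly[OF poly(2,3)] inner_diff_right set_integral_diff(2)[OF int1 int2])
      moreover have "(LINT x:?S K|lborel. v t K x * vt K x + grad (v t K) x \<bullet> grad (u t K) x) =
          (LINT x:?S K|lborel. v t K x * vt K x) + (LINT x:?S K|lborel. grad (u t K) x \<bullet> grad (v t K) x)"
        using set_integral_add(2)[OF int3 int2] by (simp add: inner_commute)
      ultimately show ?thesis by (simp add: inner_commute mult.commute)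
    qed
    have "E = (\<Sum>K\<in>active_mesh M. LINT x:?S K|lborel. grad (u t K) x \<bullet> grad (\<lambda>y. ut K y - v t K y) x) +
        (\<Sum>K\<in>active_mesh M. LINT x:?S K|lborel. v t K x * vt K x + grad (v t K) x \<bullet> grad (u t K) x)"
      unfolding E_def sum.distrib[symmetric] by (intro sum.cong refl cell[symmetric])
    then have "D = (\<Sum>K\<in>active_mesh M. LINT x:frontier (?S K)|surface_measure.
        (flux_v M \<alpha> \<tau> (u t) (v t) x - v t K x) * (grad (u t K) x \<bullet> outward_normal (?S K) x)) +
      (\<Sum>K\<in>active_mesh M. LINT x:frontier (?S K)|surface_measure.
        v t K x * (flux_grad_u M \<alpha> \<beta> (u t) (v t) K x \<bullet> outward_normal (?S K) x))"
      using eq_u eq_v by (simp add: cutedg_eq_u_def cutedg_eq_v_def D_def)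
    also have "\<dots> \<le> 0"
      by (rule boundary_terms_nonpos[OF M u[OF U(2)] v[OF U(2)] assms(5,6)])
    finally show ?thesis .
  qed
  ultimately show ?thesis by auto
qed

end
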